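(* Let $H$ be a complex inner product space (not necessarily complete) with $\dim H\geq 3$ (possibly infinite), and let $\alpha\in\left(0,\tfrac{\pi}{4}\right]$. Assume that $\phi\colon P(H)\to P(H)$ is a bijective map such that $$\measuredangle([u],[v])=\alpha \iff \measuredangle(\phi([u]),\phi([v]))=\alpha \quad ([u],[v]\in P(H)).$$ Then $\phi$ is a Wigner symmetry, i.e. there exists a bijective linear or conjugate-linear isometry $U\colon H\to H$ such that $\phi([v])=[Uv]$ for every $[v]\in P(H)$.
   Context: $P(H)$ is the set of all one-dimensional subspaces (lines) of $H$; for $0\neq v\in H$, $[v]$ is the line generated by $v$. The angle between lines is $\measuredangle([u],[v])=\arccos\frac{|\langle u,v\rangle|}{\|u\|\,\|v\|}\in\left[0,\tfrac{\pi}{2}\right]$. *)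

theory Defs
  imports "HOL-Analysis.Analysis"
begin

text \<open>
  A complex inner product space, carried by its underlying real inner product space (the realification,
  with inner product \<open>Re \<langle>x, y\<rangle>\<close>), so that \<^const>\<open>norm\<close> and \<^const>\<open>dist\<close> are the
  usual ones. This is no restriction: the real structure is determined by \<open>scaleC\<close> and
  \<open>cinner\<close>, and positive definiteness of \<open>cinner\<close> is inherited from \<^class>\<open>real_inner\<close>.
  Completeness is not assumed.
\<close>

class complex_inner = real_inner +
  fixes scaleC :: "complex \<Rightarrow> 'a \<Rightarrow> 'a"  (infixr \<open>*\<^sub>C\<close> 75)
    and cinner :: "'a \<Rightarrow> 'a \<Rightarrow> complex"
  assumes scaleC_add_right: "c *\<^sub>C (x + y) = c *\<^sub>C x + c *\<^sub>C y"
    and scaleC_add_left: "(c + d) *\<^sub>C x = c *\<^sub>C x + d *\<^sub>C x"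
    and scaleC_scaleC: "c *\<^sub>C d *\<^sub>C x = (c * d) *\<^sub>C x"
    and scaleC_one: "1 *\<^sub>C x = x"
    and scaleR_scaleC: "r *\<^sub>R x = complex_of_real r *\<^sub>C x"
    and cinner_commute: "cinner x y = cnj (cinner y x)"
    and cinner_add_left: "cinner (x + y) z = cinner x z + cinner y z"
    and cinner_scaleC_left: "cinner (c *\<^sub>C x) y = c * cinner x y"
    and inner_eq_Re_cinner: "inner x y = Re (cinner x y)"

lemma cinner_self: "cinner x x = complex_of_real ((norm x)\<^sup>2)"
  for x :: "'a::complex_inner"
proof (rule complex_eqI)
  show "Re (cinner x x) = Re (complex_of_real ((norm x)\<^sup>2))"
    by (simp add: power2_norm_eq_inner inner_eq_Re_cinner)
  have "Im (cinner x x) = - Im (cinner x x)"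
    by (subst cinner_commute) simp
  then show "Im (cinner x x) = Im (complex_of_real ((norm x)\<^sup>2))"
    by simp
qed

lemma cinner_scaleC_right: "cinner x (c *\<^sub>C y) = cnj c * cinner x y"
  for x :: "'a::complex_inner"
  by (subst (1 2) cinner_commute) (simp add: cinner_scaleC_left)

lemma norm_scaleC: "norm (c *\<^sub>C x) = cmod c * norm x"
  for x :: "'a::complex_inner"
proof -
  have "complex_of_real ((norm (c *\<^sub>C x))\<^sup>2) = (c * cnj c) * cinner x x"
    by (simp only: cinner_self [symmetric] cinner_scaleC_left cinner_scaleC_right mult_ac)
  also have "\<dots> = complex_of_real ((cmod c * norm x)\<^sup>2)"
    by (simp only: complex_norm_square [symmetric] cinner_self power_mult_distrib of_real_mult)
  finally have "(norm (c *\<^sub>C x))\<^sup>2 = (cmod c * norm x)\<^sup>2"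
    using of_real_eq_iff by blast
  then show ?thesis
    by (simp add: power2_eq_iff_nonneg)
qed

global_interpretation complex_vector:
  vector_space "scaleC :: complex \<Rightarrow> 'a \<Rightarrow> 'a::complex_inner"
  defines cdependent = complex_vector.dependent
    and crepresentation = complex_vector.representation
    and csubspace = complex_vector.subspace
    and cspan = complex_vector.span
    and cextend_basis = complex_vector.extend_basis
    and cdim = complex_vector.dim
  by unfold_locales (simp_all add: scaleC_add_right scaleC_add_left scaleC_scaleC scaleC_one)

text \<open>
  \<open>dim H \<ge> n\<close> in terms of the size of a Hamel basis; \<^const>\<open>cdim\<close> itself cannot be used, as it is
  \<open>0\<close> for infinite-dimensional spaces.
\<close>

definition cdim_at_least :: "nat \<Rightarrow> 'a::complex_inner itself \<Rightarrow> bool" where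
  "cdim_at_least n _ \<longleftrightarrow>
     (\<exists>B :: 'a set. \<not> cdependent B \<and> cspan B = UNIV \<and> (infinite B \<or> n \<le> card B))"

definition lines :: "'a::complex_inner set set" where
  "lines = {L. csubspace L \<and> cdim L = 1}"

definition line_through :: "'a::complex_inner \<Rightarrow> 'a set" where
  "line_through v = cspan {v}"

lemma lines_eq: "lines = {line_through v | v :: 'a::complex_inner. v \<noteq> 0}"
proof (intro set_eqI iffI)
  fix L :: "'a set"
  assume "L \<in> lines"
  then have L: "csubspace L" "cdim L = 1"
    by (auto simp: lines_def)
  obtain B where B: "B \<subseteq> L" "\<not> cdependent B" "L \<subseteq> cspan B" "card B = cdim L"
    by (rule complex_vector.basis_exists)
  then obtain v where v: "B = {v}"
    using L(2) by (metis card_1_singletonE)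
  have "cspan B = L"
    using B L(1) by (metis complex_vector.span_subspace)
  moreover have "v \<noteq> 0"
    using B(2) v by (metis complex_vector.dependent_zero singletonI)
  ultimately show "L \<in> {line_through v | v. v \<noteq> 0}"
    using v by (auto simp: line_through_def)
next
  fix L :: "'a set"
  assume "L \<in> {line_through v | v. v \<noteq> 0}"
  then obtain v where v: "v \<noteq> 0" "L = cspan {v}"
    by (auto simp: line_through_def)
  then have "cdim L = card {v}"
    by (metis complex_vector.dim_span_eq_card_independent complex_vector.dependent_single)
  then show "L \<in> lines"
    by (simp add: lines_def v)
qed

text \<open>
  The angle is computed from arbitrarily chosen generators of the two lines; the lemma
  \<open>line_angle_line_through\<close> below shows that the choice does not matter.
\<close>

definition line_angle :: "'a::complex_inner set \<Rightarrow> 'a set \<Rightarrow> real" where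
  "line_angle L M =
     (let u = (SOME u. u \<noteq> 0 \<and> L = line_through u);
          v = (SOME v. v \<noteq> 0 \<and> M = line_through v)
      in arccos (cmod (cinner u v) / (norm u * norm v)))"

lemma line_through_eqD:
  fixes u v :: "'a::complex_inner"
  assumes "line_through u = line_through v" "u \<noteq> 0"
  obtains c where "c \<noteq> 0" "u = c *\<^sub>C v"
proof -
  have "u \<in> cspan {v}"
    using assms(1) complex_vector.span_base [of u "{u}"] by (simp add: line_through_def)
  then obtain c where c: "u = c *\<^sub>C v"
    by (auto simp: complex_vector.span_singleton)
  with assms(2) have "c \<noteq> 0"
    by auto
  with c that show thesis
    by blast
qed

lemma line_angle_line_through:
  fixes u v :: "'a::complex_inner"
  assumes "u \<noteq> 0" "v \<noteq> 0"
  shows "line_angle (line_through u) (line_through v) =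
    arccos (cmod (cinner u v) / (norm u * norm v))"
proof -
  define u' where "u' = (SOME w. w \<noteq> 0 \<and> line_through u = line_through w)"
  define v' where "v' = (SOME w. w \<noteq> 0 \<and> line_through v = line_through w)"
  have u': "u' \<noteq> 0 \<and> line_through u = line_through u'"
    unfolding u'_def by (rule someI [of _ u]) (simp add: assms)
  have v': "v' \<noteq> 0 \<and> line_through v = line_through v'"
    unfolding v'_def by (rule someI [of _ v]) (simp add: assms)
  obtain a where a: "a \<noteq> 0" "u' = a *\<^sub>C u"
    using u' line_through_eqD [of u' u] by metis
  obtain b where b: "b \<noteq> 0" "v' = b *\<^sub>C v"
    using v' line_through_eqD [of v' v] by metis
  have "cmod (cinner u' v') / (norm u' * norm v') = cmod (cinner u v) / (norm u * norm v)"
    using a b by (simp add: cinner_scaleC_left cinner_scaleC_right norm_scaleC norm_mult)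
  then show ?thesis
    by (simp add: line_angle_def Let_def u'_def v'_def)
qed

definition conjugate_linear :: "('a::complex_inner \<Rightarrow> 'b::complex_inner) \<Rightarrow> bool" where
  "conjugate_linear U \<longleftrightarrow>
     (\<forall>x y. U (x + y) = U x + U y) \<and> (\<forall>c x. U (c *\<^sub>C x) = cnj c *\<^sub>C U x)"

definition Wigner_symmetry :: "('a::complex_inner set \<Rightarrow> 'a set) \<Rightarrow> bool" where
  "Wigner_symmetry \<phi> \<longleftrightarrow>
     (\<exists>U. bij U \<and> (Vector_Spaces.linear scaleC scaleC U \<or> conjugate_linear U) \<and>
          (\<forall>x y. dist (U x) (U y) = dist x y) \<and>
          (\<forall>v. v \<noteq> 0 \<longrightarrow> \<phi> (line_through v) = line_through (U v)))"

end

theory Submission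
  imports Defs
begin

text \<open>
  Write \<open>d\<close> for the angle metric on lines. If the relations \<open>d \<le> a\<close> and \<open>d \<le> b\<close> are preserved
  in both directions, then so are \<open>d \<le> a + b\<close>, because the metric is geodesic, and \<open>d \<le> b - a\<close> for
  \<open>a \<le> b < \<pi>/2\<close>, which holds exactly when the ball of radius \<open>a\<close> around one line lies in the ball
  of radius \<open>b\<close> around the other. Given \<open>\<delta> < \<pi>/4\<close> with \<open>d \<le> \<delta>\<close> preserved, a configuration of
  two lines at angle \<open>2\<delta>\<close> and their unique midpoint defines \<open>d \<le> h\<close> with
  \<open>cos h = cos 2\<delta> / cos \<delta>\<close>. As \<open>\<delta> < h < 2\<delta>\<close>, one of \<open>h - \<delta>\<close> and \<open>2\<delta> - h\<close> is at most \<open>\<delta>/2\<close>.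
  So \<open>d \<le> a\<close> is preserved for arbitrarily small \<open>a\<close> and their multiples, the map is an isometry of
  \<open>d\<close>, and Wigner's theorem applies.

  For \<open>\<alpha> < \<pi>/4\<close> one can start with \<open>\<delta> = \<alpha>\<close>: having a common neighbour means \<open>d \<le> 2\<alpha>\<close>, and the
  sphere of radius \<open>\<alpha>\<close> around one line lies in the ball of radius \<open>2\<alpha>\<close> around another exactly when
  \<open>d \<le> \<alpha>\<close>. For \<open>\<alpha> = \<pi>/4\<close> these relations are void; instead the adjacencies among common
  neighbours detect orthogonality, orthogonality detects the angle \<open>\<pi>/3\<close>, and thereby \<open>d < \<pi>/6\<close>.
\<close>

subsection \<open>Inner products and angles\<close>

lemma cinner_add_right: "cinner x (y + z) = cinner x y + cinner x z"
  for x :: "'a::complex_inner"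
  by (subst (1 2 3) cinner_commute) (simp add: cinner_add_left)

lemma scaleC_minus_one: "(- 1) *\<^sub>C x = - x"
  for x :: "'a::complex_inner"
  using complex_vector.scale_minus_left[of 1 x] by (simp add: scaleC_one)

lemma cinner_minus_left: "cinner (- x) y = - cinner x y"
  for x :: "'a::complex_inner"
  using cinner_scaleC_left[of "- 1" x y] by (simp add: scaleC_minus_one)

lemma cinner_minus_right: "cinner x (- y) = - cinner x y"
  for x :: "'a::complex_inner"
  using cinner_scaleC_right[of x "- 1" y] by (simp add: scaleC_minus_one)

lemma cinner_diff_left: "cinner (x - y) z = cinner x z - cinner y z"
  for x :: "'a::complex_inner"
  using cinner_add_left[of x "- y" z] by (simp add: cinner_minus_left)

lemma cinner_diff_right: "cinner x (y - z) = cinner x y - cinner x z"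
  for x :: "'a::complex_inner"
  using cinner_add_right[of x y "- z"] by (simp add: cinner_minus_right)

lemma cinner_zero_left [simp]: "cinner 0 x = 0"
  for x :: "'a::complex_inner"
  using cinner_diff_left[of 0 0 x] by simp

lemma cinner_zero_right [simp]: "cinner x 0 = 0"
  for x :: "'a::complex_inner"
  using cinner_diff_right[of x 0 0] by simp

lemmas cinner_simps =
  cinner_add_left cinner_add_right cinner_diff_left cinner_diff_right
  cinner_minus_left cinner_minus_right cinner_scaleC_left cinner_scaleC_right

lemma cinner_eq_zero_commute: "cinner x y = 0 \<longleftrightarrow> cinner y x = 0"
  for x :: "'a::complex_inner"
  by (subst cinner_commute) simp

lemma cmod_cinner_commute: "cmod (cinner x y) = cmod (cinner y x)"
  for x :: "'a::complex_inner"
  by (subst cinner_commute) simp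

lemma norm_sq_eq_Re_cinner: "(norm x)\<^sup>2 = Re (cinner x x)"
  for x :: "'a::complex_inner"
  by (simp add: cinner_self)

lemma norm_eq_1_iff_cinner: "norm x = 1 \<longleftrightarrow> cinner x x = 1"
  for x :: "'a::complex_inner"
proof -
  have "norm x = 1 \<longleftrightarrow> (norm x)\<^sup>2 = 1\<^sup>2"
    by (subst power2_eq_iff_nonneg) auto
  then show ?thesis
    unfolding cinner_self of_real_eq_1_iff by simp
qed

lemma norm_add_scaleC_sq:
  fixes z x :: "'a::complex_inner"
  assumes "cinner z x = 0"
  shows "(norm (a *\<^sub>C z + x))\<^sup>2 = (cmod a * norm z)\<^sup>2 + (norm x)\<^sup>2"
proof -
  have "cinner x z = 0"
    using assms cinner_eq_zero_commute by blast
  then have "complex_of_real ((norm (a *\<^sub>C z + x))\<^sup>2) = a * cnj a * cinner z z + cinner x x"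
    using assms by (simp only: cinner_self [symmetric] cinner_simps) (simp add: algebra_simps)
  also have "\<dots> = complex_of_real ((cmod a * norm z)\<^sup>2 + (norm x)\<^sup>2)"
    by (simp only: complex_norm_square [symmetric] cinner_self power_mult_distrib of_real_mult of_real_add)
  finally show ?thesis
    using of_real_eq_iff by blast
qed

lemma cinner_residual:
  fixes x z :: "'a::complex_inner"
  assumes "norm z = 1"
  shows "cinner z (x - cinner x z *\<^sub>C z) = 0"
  using assms by (simp add: cinner_simps norm_eq_1_iff_cinner) (subst cinner_commute, simp)

text \<open>Pythagoras. Nonnegativity of the left-hand side gives Cauchy-Schwarz, and its vanishing
  gives the equality cases used later.\<close>

lemma norm_residual:
  fixes x z :: "'a::complex_inner"
  assumes "norm z = 1"
  shows "(norm (x - cinner x z *\<^sub>C z))\<^sup>2 = (norm x)\<^sup>2 - (cmod (cinner x z))\<^sup>2"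
  using norm_add_scaleC_sq[OF cinner_residual[OF assms], of "cinner x z" x] assms by simp

lemma cmod_cinner_le: "cmod (cinner x y) \<le> norm x * norm y"
  for x y :: "'a::complex_inner"
proof (cases "y = 0")
  case False
  define z where "z = complex_of_real (1 / norm y) *\<^sub>C y"
  have z: "norm z = 1"
    using False by (simp add: z_def norm_scaleC norm_divide)
  have "(cmod (cinner x z))\<^sup>2 \<le> (norm x)\<^sup>2"
    using norm_residual[OF z, of x] zero_le_power2[of "norm (x - cinner x z *\<^sub>C z)"] by linarith
  then have "cmod (cinner x z) \<le> norm x"
    by (simp add: abs_le_square_iff [symmetric])
  then show ?thesis
    using False by (simp add: z_def cinner_simps norm_mult norm_divide field_simps)
qed simp

lemma cmod_cinner_le_1: "norm x = 1 \<Longrightarrow> norm y = 1 \<Longrightarrow> cmod (cinner x y) \<le> 1"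
  for x y :: "'a::complex_inner"
  using cmod_cinner_le[of x y] by simp

lemma cmod_cinner_eq_1D:
  fixes x z :: "'a::complex_inner"
  assumes "norm x = 1" "norm z = 1" "cmod (cinner x z) = 1"
  shows "x = cinner x z *\<^sub>C z"
  using norm_residual[OF assms(2), of x] assms by simp

section \<open>Unit representatives of lines and the angle metric\<close>

lemma line_through_scaleC:
  fixes v :: "'a::complex_inner"
  assumes "c \<noteq> 0"
  shows "line_through (c *\<^sub>C v) = line_through v"
proof
  show "line_through (c *\<^sub>C v) \<subseteq> line_through v"
    unfolding line_through_def complex_vector.span_singleton by (auto simp: scaleC_scaleC)
  have "k *\<^sub>C v = (k / c) *\<^sub>C c *\<^sub>C v" for k
    using assms by (simp add: scaleC_scaleC)
  then show "line_through v \<subseteq> line_through (c *\<^sub>C v)"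
    unfolding line_through_def complex_vector.span_singleton by blast
qed

lemma line_through_in_lines [simp]: "v \<noteq> 0 \<Longrightarrow> line_through v \<in> lines"
  by (auto simp: lines_eq)

lemma line_through_unit_in_lines [simp]: "norm v = 1 \<Longrightarrow> line_through v \<in> lines"
  by (rule line_through_in_lines) auto

lemma lines_unitE:
  fixes L :: "'a::complex_inner set"
  assumes "L \<in> lines"
  obtains u where "norm u = 1" "L = line_through u"
proof -
  obtain v where v: "v \<noteq> 0" "L = line_through v"
    using assms by (auto simp: lines_eq)
  show thesis
    by (rule that[of "complex_of_real (1 / norm v) *\<^sub>C v"])
      (use v in \<open>simp_all add: norm_scaleC norm_divide line_through_scaleC\<close>)
qed

lemma line_angle_unit:
  fixes u v :: "'a::complex_inner"
  assumes "norm u = 1" "norm v = 1"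
  shows "line_angle (line_through u) (line_through v) = arccos (cmod (cinner u v))"
  using assms by (subst line_angle_line_through) auto

lemma cos_line_angle_unit:
  fixes u v :: "'a::complex_inner"
  assumes "norm u = 1" "norm v = 1"
  shows "cos (line_angle (line_through u) (line_through v)) = cmod (cinner u v)"
  using cmod_cinner_le_1[OF assms] by (simp add: line_angle_unit assms cos_arccos_abs)

lemma line_angle_bounds:
  fixes L M :: "'a::complex_inner set"
  assumes "L \<in> lines" "M \<in> lines"
  shows "0 \<le> line_angle L M" "line_angle L M \<le> pi / 2"
proof -
  obtain u v where "norm u = 1" "L = line_through u" "norm v = 1" "M = line_through v"
    using assms by (metis lines_unitE)
  then show "0 \<le> line_angle L M" "line_angle L M \<le> pi / 2"
    using cmod_cinner_le_1[of u v] arccos_lbound[of "cmod (cinner u v)"]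
      arccos_le_pi2[of "cmod (cinner u v)"] order_trans[of "- 1" 0 "cmod (cinner u v)"]
    by (simp_all add: line_angle_unit)
qed

lemma line_angle_commute:
  fixes L M :: "'a::complex_inner set"
  assumes "L \<in> lines" "M \<in> lines"
  shows "line_angle L M = line_angle M L"
  using assms by (metis lines_unitE line_angle_unit cmod_cinner_commute)

lemma line_angle_unit_eq_iff:
  fixes u v :: "'a::complex_inner"
  assumes "norm u = 1" "norm v = 1" "0 \<le> a" "a \<le> pi / 2"
  shows "line_angle (line_through u) (line_through v) = a \<longleftrightarrow> cmod (cinner u v) = cos a"
proof -
  have "line_angle (line_through u) (line_through v) = a"
    if "cos (line_angle (line_through u) (line_through v)) = cos a"
    by (rule cos_inj_pi)
      (use that assms line_angle_bounds[of "line_through u" "line_through v"] in auto)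
  then show ?thesis
    by (metis assms(1,2) cos_line_angle_unit)
qed

lemma line_angle_le_iff_cos:
  fixes L M :: "'a::complex_inner set"
  assumes "L \<in> lines" "M \<in> lines" "0 \<le> a" "a \<le> pi"
  shows "line_angle L M \<le> a \<longleftrightarrow> cos a \<le> cos (line_angle L M)"
  using line_angle_bounds[OF assms(1,2)] assms by (intro cos_mono_le_eq [symmetric]) auto

lemma line_angle_unit_le_iff:
  fixes u v :: "'a::complex_inner"
  assumes "norm u = 1" "norm v = 1" "0 \<le> a" "a \<le> pi"
  shows "line_angle (line_through u) (line_through v) \<le> a \<longleftrightarrow> cos a \<le> cmod (cinner u v)"
  using assms by (simp add: line_angle_le_iff_cos cos_line_angle_unit)

lemma line_angle_eq_0_iff:
  fixes L M :: "'a::complex_inner set"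
  assumes "L \<in> lines" "M \<in> lines"
  shows "line_angle L M = 0 \<longleftrightarrow> L = M"
proof -
  obtain u v where uv: "norm u = 1" "L = line_through u" "norm v = 1" "M = line_through v"
    using assms by (metis lines_unitE)
  have "L = M" if "cmod (cinner u v) = 1"
  proof -
    have "u = cinner u v *\<^sub>C v" "cinner u v \<noteq> 0"
      using cmod_cinner_eq_1D uv that by auto
    then show ?thesis
      using line_through_scaleC uv by metis
  qed
  moreover have "cmod (cinner u v) = 1" if "L = M"
  proof -
    have "line_angle L M = line_angle (line_through u) (line_through u)"
      using that uv by simp
    also have "\<dots> = 0"
      using uv by (subst line_angle_unit_eq_iff) (auto simp: norm_eq_1_iff_cinner)
    finally show ?thesis
      using uv by (simp add: line_angle_unit_eq_iff)
  qed
  ultimately show ?thesis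
    using uv by (auto simp: line_angle_unit_eq_iff)
qed

text \<open>Removing the components of \<open>u\<close> and \<open>v\<close> along \<open>z\<close>
  leaves residuals of norms \<open>sin a\<close> and \<open>sin b\<close>. Hence the overlap of
  \<open>u\<close> and \<open>v\<close> is at least \<open>cos a * cos b - sin a * sin b\<close>,
  which is \<open>cos (a + b)\<close>.\<close>

lemma line_angle_triangle:
  fixes L M N :: "'a::complex_inner set"
  assumes "L \<in> lines" "M \<in> lines" "N \<in> lines"
  shows "line_angle L N \<le> line_angle L M + line_angle M N"
proof -
  obtain u v z where uv: "norm u = 1" "L = line_through u" "norm v = 1" "N = line_through v"
    "norm z = 1" "M = line_through z"
    using assms by (metis lines_unitE)
  define a where "a = line_angle L M"
  define b where "b = line_angle M N"
  have ab: "0 \<le> a" "a \<le> pi / 2" "0 \<le> b" "b \<le> pi / 2"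
    using line_angle_bounds assms by (auto simp: a_def b_def)
  have ca: "cos a = cmod (cinner u z)" and cb: "cos b = cmod (cinner v z)"
    using cos_line_angle_unit uv cmod_cinner_commute by (metis a_def, metis b_def)
  define u' where "u' = u - cinner u z *\<^sub>C z"
  define v' where "v' = v - cinner v z *\<^sub>C z"
  have "(norm u')\<^sup>2 = (sin a)\<^sup>2" "(norm v')\<^sup>2 = (sin b)\<^sup>2"
    unfolding u'_def v'_def norm_residual[OF uv(5)] by (simp_all add: uv ca cb sin_squared_eq)
  then have n: "norm u' = sin a" "norm v' = sin b"
    using ab by (auto simp: power2_eq_iff_nonneg sin_ge_zero)
  have o: "cinner z v' = 0" "cinner u' z = 0"
    using cinner_residual uv cinner_eq_zero_commute by (auto simp: v'_def u'_def)
  have "cinner u v = cinner (cinner u z *\<^sub>C z + u') (cinner v z *\<^sub>C z + v')"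
    by (simp add: u'_def v'_def)
  also have "\<dots> = cinner u z * cnj (cinner v z) + cinner u' v'"
    using o uv by (simp add: cinner_simps norm_eq_1_iff_cinner)
  finally have "cmod (cinner u v) \<ge> cmod (cinner u z * cnj (cinner v z)) - cmod (cinner u' v')"
    by (metis norm_diff_ineq)
  also have "cmod (cinner u z * cnj (cinner v z)) = cos a * cos b"
    by (simp add: norm_mult ca cb)
  finally have "cos (a + b) \<le> cmod (cinner u v)"
    using cmod_cinner_le[of u' v'] by (simp add: n cos_add)
  then show ?thesis
    using uv ab line_angle_unit_le_iff[of u v "a + b"] by (simp add: a_def b_def)
qed

text \<open>Two vectors cannot span a space of dimension at least three; Gram-Schmidt turns a vector
  outside their span into one orthogonal to both.\<close>

lemma orthogonal_unit_vector:
  fixes x y :: "'a::complex_inner"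
  assumes "cdim_at_least 3 TYPE('a)"
  obtains k :: 'a where "norm k = 1" "cinner k x = 0" "cinner k y = 0"
proof -
  obtain B :: "'a set" where B: "\<not> cdependent B" "cspan B = UNIV" "infinite B \<or> 3 \<le> card B"
    using assms by (auto simp: cdim_at_least_def)
  have "cspan {x, y} \<noteq> UNIV"
  proof
    assume "cspan {x, y} = UNIV"
    then have "B \<subseteq> cspan {x, y}"
      by simp
    then have "finite B \<and> card B \<le> card {x, y}"
      by (intro complex_vector.independent_span_bound B(1)) auto
    then show False
      using B(3) card_insert_le_m1[of 2 "{y}" x] by simp
  qed
  then obtain w where w: "w \<notin> cspan {x, y}"
    by blast
  \<comment> \<open>The vectors may be zero or dependent: division by zero then makes the
    coefficient 0, and the projection term drops out.\<close>
  define y' where "y' = y - (cinner y x / cinner x x) *\<^sub>C x"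
  define w' where "w' = w - (cinner w x / cinner x x) *\<^sub>C x - (cinner w y' / cinner y' y') *\<^sub>C y'"
  have yx: "cinner y' x = 0"
    by (cases "x = 0") (simp_all add: y'_def cinner_simps cinner_self)
  then have xy: "cinner x y' = 0"
    by (simp add: cinner_eq_zero_commute)
  have wx: "cinner w' x = 0"
    by (cases "x = 0") (simp_all add: w'_def cinner_simps yx cinner_self)
  have wy': "cinner w' y' = 0"
    by (cases "y' = 0") (simp_all add: w'_def cinner_simps xy cinner_self)
  have "y = y' + (cinner y x / cinner x x) *\<^sub>C x"
    by (simp add: y'_def)
  then have wy: "cinner w' y = 0"
    using wx wy' by (metis add.right_neutral cinner_add_right cinner_scaleC_right mult_zero_right)
  have "y' \<in> cspan {x, y}"
    unfolding y'_def
    by (intro complex_vector.span_diff complex_vector.span_scale complex_vector.span_base) auto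
  moreover have "w - w' = (cinner w x / cinner x x) *\<^sub>C x + (cinner w y' / cinner y' y') *\<^sub>C y'"
    by (simp add: w'_def)
  ultimately have "w - w' \<in> cspan {x, y}"
    by (simp add: complex_vector.span_add complex_vector.span_scale complex_vector.span_base)
  then have w': "w' \<noteq> 0"
    using w by auto
  show thesis
    by (rule that[of "complex_of_real (1 / norm w') *\<^sub>C w'"])
      (use w' wx wy in \<open>simp_all add: norm_scaleC norm_divide cinner_simps\<close>)
qed

subsection \<open>Triangles of lines\<close>

lemma cinner_orthonormal:
  fixes u f g :: "'a::complex_inner"
  assumes "norm u = 1" "norm f = 1" "norm g = 1" "cinner u f = 0" "cinner u g = 0" "cinner f g = 0"
  shows "cinner (a *\<^sub>C u + b *\<^sub>C f + c *\<^sub>C g) (a' *\<^sub>C u + b' *\<^sub>C f + c' *\<^sub>C g) =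
    a * cnj a' + b * cnj b' + c * cnj c'"
proof -
  have "cinner f u = 0" "cinner g u = 0" "cinner g f = 0"
    using assms cinner_eq_zero_commute by auto
  then show ?thesis
    using assms by (simp add: cinner_simps norm_eq_1_iff_cinner algebra_simps)
qed

lemma norm_orthonormal_eq_1:
  fixes u f g :: "'a::complex_inner"
  assumes "norm u = 1" "norm f = 1" "norm g = 1" "cinner u f = 0" "cinner u g = 0" "cinner f g = 0"
    and "(cmod a)\<^sup>2 + (cmod b)\<^sup>2 + (cmod c)\<^sup>2 = 1"
  shows "norm (a *\<^sub>C u + b *\<^sub>C f + c *\<^sub>C g) = 1"
proof -
  have "complex_of_real ((cmod a)\<^sup>2 + (cmod b)\<^sup>2 + (cmod c)\<^sup>2) = 1"
    using assms(7) by simp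
  then have "a * cnj a + b * cnj b + c * cnj c = 1"
    by (simp only: of_real_add complex_norm_square)
  then show ?thesis
    unfolding norm_eq_1_iff_cinner by (simp only: cinner_orthonormal[OF assms(1-6)])
qed

context
  assumes dim3: "cdim_at_least 3 TYPE('a::complex_inner)"
begin

text \<open>Coordinates for computing with two lines: \<open>u\<close> and \<open>f\<close> span a
  plane containing both, and \<open>g\<close> is a direction outside it. The term
  \<open>0 *\<^sub>C g\<close> matches the shape of \<open>cinner_orthonormal\<close>.\<close>

lemma lines_orthonormalE:
  fixes L M :: "'a set"
  assumes "L \<in> lines" "M \<in> lines"
  obtains u f g t where
    "norm u = 1" "norm f = 1" "norm g = 1" "cinner u f = 0" "cinner u g = 0" "cinner f g = 0"
    "t = line_angle L M" "0 \<le> t" "t \<le> pi / 2" "L = line_through u"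
    "M = line_through (complex_of_real (cos t) *\<^sub>C u + complex_of_real (sin t) *\<^sub>C f + 0 *\<^sub>C g)"
proof -
  obtain u v0 where uv: "norm u = 1" "L = line_through u" "norm v0 = 1" "M = line_through v0"
    using assms by (metis lines_unitE)
  define t where "t = line_angle L M"
  have t: "0 \<le> t" "t \<le> pi / 2"
    using line_angle_bounds assms by (auto simp: t_def)
  have ct: "cmod (cinner v0 u) = cos t"
    using cos_line_angle_unit uv cmod_cinner_commute by (metis t_def)
  \<comment> \<open>The phase \<open>c\<close> turns the inner product of the representatives into
    the real number \<open>cos t\<close>; for orthogonal lines any phase does.\<close>
  obtain c where c: "cmod c = 1" "c * cinner v0 u = complex_of_real (cos t)"
  proof (cases "cinner v0 u = 0")
    case True
    then show thesis
      using that[of 1] ct by simp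
  next
    case False
    have "cmod (complex_of_real (cos t) / cinner v0 u) = 1"
      unfolding ct [symmetric] using False by (simp add: norm_divide)
    then show thesis
      using False that[of "complex_of_real (cos t) / cinner v0 u"] by simp
  qed
  define v where "v = c *\<^sub>C v0"
  have v: "norm v = 1" "M = line_through v" "cinner v u = complex_of_real (cos t)"
    using uv c norm_eq_zero[of c]
    by (simp_all add: v_def norm_scaleC cinner_simps line_through_scaleC del: norm_eq_zero)
  define w where "w = v - complex_of_real (cos t) *\<^sub>C u"
  have uw: "cinner u w = 0"
    using cinner_residual[OF uv(1), of v] by (simp add: w_def v(3))
  have "(norm w)\<^sup>2 = (sin t)\<^sup>2"
    using norm_residual[OF uv(1), of v] by (simp add: w_def v(1,3) sin_squared_eq)
  then have nw: "norm w = sin t"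
    using t by (auto simp: power2_eq_iff_nonneg sin_ge_zero)
  \<comment> \<open>If \<open>sin t = 0\<close>, the residual \<open>w\<close> vanishes and any unit
    vector orthogonal to \<open>u\<close> serves as \<open>f\<close>.\<close>
  obtain f where f: "norm f = 1" "cinner u f = 0" "w = complex_of_real (sin t) *\<^sub>C f"
  proof (cases "sin t = 0")
    case True
    obtain k :: 'a where "norm k = 1" "cinner k u = 0"
      using orthogonal_unit_vector[OF dim3] by metis
    then show thesis
      using that[of k] nw True cinner_eq_zero_commute by auto
  next
    case False
    then have "sin t > 0"
      using t by (simp add: order_less_le sin_ge_zero)
    then show thesis
      using that[of "complex_of_real (1 / sin t) *\<^sub>C w"] nw uw False
      by (simp add: norm_scaleC norm_divide cinner_simps scaleC_scaleC scaleC_one)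
  qed
  obtain g :: 'a where g: "norm g = 1" "cinner g u = 0" "cinner g f = 0"
    using orthogonal_unit_vector[OF dim3] by metis
  have "v = complex_of_real (cos t) *\<^sub>C u + complex_of_real (sin t) *\<^sub>C f + 0 *\<^sub>C g"
    using f(3) by (simp add: w_def algebra_simps)
  then show thesis
    using that[of u f g t] f g uv v t cinner_eq_zero_commute t_def by metis
qed

text \<open>
  The third dimension provides a vector orthogonal to both lines. It makes the cosine of the angle
  to \<open>M\<close> affine in the free parameter, and frees the statement from the perimeter condition
  that a triangle in a complex projective line satisfies.
\<close>

lemma line_triangle_exists:
  fixes L M :: "'a set"
  assumes "L \<in> lines" "M \<in> lines" "0 \<le> a" "0 \<le> b" "b \<le> pi / 2"
    and "\<bar>a - b\<bar> \<le> line_angle L M" "line_angle L M \<le> a + b" "a \<le> pi / 2"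
  obtains Z where "Z \<in> lines" "line_angle L Z = a" "line_angle Z M = b"
proof -
  obtain u f g t where on:
    "norm u = 1" "norm f = 1" "norm g = 1" "cinner u f = 0" "cinner u g = 0" "cinner f g = 0"
    and t: "t = line_angle L M" "0 \<le> t" "t \<le> pi / 2"
    and L: "L = line_through u"
    and M: "M = line_through (complex_of_real (cos t) *\<^sub>C u + complex_of_real (sin t) *\<^sub>C f + 0 *\<^sub>C g)"
    using lines_orthonormalE[OF assms(1,2)] by metis
  define m where "m = sin t * sin a"
  have m: "0 \<le> m"
    using assms t by (auto simp: m_def intro!: mult_nonneg_nonneg sin_ge_zero)
  have up: "cos b \<le> cos t * cos a + m"
  proof -
    have "cos \<bar>b\<bar> \<le> cos \<bar>t - a\<bar>"
      by (rule cos_monotone_0_pi_le) (use assms t in auto)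
    then show ?thesis
      by (simp add: cos_diff m_def)
  qed
  have "cos (t + a) \<le> cos b"
    by (rule cos_monotone_0_pi_le) (use assms t in auto)
  then have lo: "cos t * cos a - m \<le> cos b"
    by (simp add: cos_add m_def)
  \<comment> \<open>\<open>\<kappa>\<close> is the share of \<open>sin a\<close> that
    \<open>z\<close> puts on \<open>f\<close>, the rest going to \<open>g\<close>. As it runs
    through [-1, 1], the overlap with \<open>M\<close> runs affinely from \<open>cos (t + a)\<close>
    to \<open>cos (t - a)\<close>.\<close>
  obtain \<kappa> where \<kappa>: "\<bar>\<kappa>\<bar> \<le> 1" "cos t * cos a + \<kappa> * m = cos b"
  proof (cases "m = 0")
    case True
    then show thesis
      using that[of 0] up lo by simp
  next
    case False
    then show thesis
      using that[of "(cos b - cos t * cos a) / m"] up lo m by (auto simp: abs_le_iff field_simps)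
  qed
  define z where "z = complex_of_real (cos a) *\<^sub>C u + complex_of_real (sin a * \<kappa>) *\<^sub>C f +
    complex_of_real (sin a * sqrt (1 - \<kappa>\<^sup>2)) *\<^sub>C g"
  have k2: "\<kappa>\<^sup>2 \<le> 1"
    using \<kappa>(1) by (simp add: abs_square_le_1)
  have "(cos a)\<^sup>2 + (sin a * \<kappa>)\<^sup>2 + (sin a * sqrt (1 - \<kappa>\<^sup>2))\<^sup>2 = 1"
    using k2 by (simp add: power_mult_distrib algebra_simps)
  then have z: "norm z = 1"
    unfolding z_def by (intro norm_orthonormal_eq_1 on) (simp add: norm_mult power_mult_distrib)
  have "cinner (1 *\<^sub>C u + 0 *\<^sub>C f + 0 *\<^sub>C g) z = cos a"
    unfolding z_def cinner_orthonormal[OF on] by simp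
  then have uz: "cinner u z = cos a"
    by (simp add: scaleC_one)
  define v where "v = complex_of_real (cos t) *\<^sub>C u + complex_of_real (sin t) *\<^sub>C f + 0 *\<^sub>C g"
  have v: "norm v = 1"
    unfolding v_def by (intro norm_orthonormal_eq_1 on) simp
  have "cinner z v = complex_of_real (cos t * cos a + \<kappa> * m)"
    unfolding z_def v_def cinner_orthonormal[OF on] by (simp add: m_def)
  then have zv: "cinner z v = cos b"
    by (simp only: \<kappa>)
  have "cos a \<ge> 0" "cos b \<ge> 0"
    using assms by (auto intro!: cos_ge_zero)
  then have "line_angle L (line_through z) = a" "line_angle (line_through z) M = b"
    unfolding L M v_def[symmetric] using assms
    by (subst line_angle_unit_eq_iff; simp add: on z v uz zv)+
  then show thesis
    using that[of "line_through z"] z by simp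
qed

text \<open>Translates the existence of common neighbours at prescribed angles into bounds on a
  single angle. Necessity is the triangle inequality for each of the three sides.\<close>

lemma line_triangle_iff:
  fixes L M :: "'a set"
  assumes "L \<in> lines" "M \<in> lines" "0 \<le> a" "a \<le> pi / 2" "0 \<le> b" "b \<le> pi / 2"
  shows "(\<exists>Z\<in>lines. line_angle L Z = a \<and> line_angle Z M = b) \<longleftrightarrow>
    \<bar>a - b\<bar> \<le> line_angle L M \<and> line_angle L M \<le> a + b"
proof
  assume "\<exists>Z\<in>lines. line_angle L Z = a \<and> line_angle Z M = b"
  then obtain Z where "Z \<in> lines" "line_angle L Z = a" "line_angle Z M = b"
    by blast
  then show "\<bar>a - b\<bar> \<le> line_angle L M \<and> line_angle L M \<le> a + b"
    using line_angle_triangle[of L Z M] line_angle_triangle[of L M Z] line_angle_triangle[of Z L M]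
      line_angle_commute[of Z M] line_angle_commute[of Z L] assms by auto
next
  assume "\<bar>a - b\<bar> \<le> line_angle L M \<and> line_angle L M \<le> a + b"
  then show "\<exists>Z\<in>lines. line_angle L Z = a \<and> line_angle Z M = b"
    using line_triangle_exists assms by metis
qed

section \<open>Balls and spheres of the angle metric\<close>

lemma line_angle_le_add_iff:
  fixes L M :: "'a set"
  assumes "L \<in> lines" "M \<in> lines" "0 \<le> a" "0 \<le> b"
  shows "line_angle L M \<le> a + b \<longleftrightarrow> (\<exists>Z\<in>lines. line_angle L Z \<le> a \<and> line_angle Z M \<le> b)"
proof
  assume le: "line_angle L M \<le> a + b"
  define t where "t = line_angle L M"
  have t: "0 \<le> t" "t \<le> pi / 2"
    using line_angle_bounds assms by (auto simp: t_def)
  \<comment> \<open>\<open>Z\<close> lies on a shortest path from \<open>L\<close> to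
    \<open>M\<close>, at distance \<open>a\<close>, or at \<open>M\<close> itself if that is
    nearer.\<close>
  have "\<exists>Z\<in>lines. line_angle L Z = min a t \<and> line_angle Z M = t - min a t"
    by (subst line_triangle_iff) (use t assms in \<open>auto simp: t_def\<close>)
  moreover have "min a t \<le> a" "t - min a t \<le> b"
    using le assms by (auto simp: t_def)
  ultimately show "\<exists>Z\<in>lines. line_angle L Z \<le> a \<and> line_angle Z M \<le> b"
    by metis
next
  assume "\<exists>Z\<in>lines. line_angle L Z \<le> a \<and> line_angle Z M \<le> b"
  then show "line_angle L M \<le> a + b"
    using line_angle_triangle assms by fastforce
qed

text \<open>The point of the sphere furthest from \<open>M\<close> continues the geodesic from
  \<open>M\<close> through \<open>L\<close>. Its angle to \<open>M\<close> is \<open>t + a\<close>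
  cut off at \<pi>/2, and \<open>b < pi / 2\<close> excludes the cut-off.\<close>

lemma line_sphere_subset_ball_iff:
  fixes L M :: "'a set"
  assumes "L \<in> lines" "M \<in> lines" "0 \<le> a" "a \<le> b" "b < pi / 2"
  shows "line_angle L M \<le> b - a \<longleftrightarrow>
    (\<forall>Z\<in>lines. line_angle L Z = a \<longrightarrow> line_angle Z M \<le> b)"
proof (rule iffI, intro ballI impI)
  fix Z :: "'a set"
  assume "Z \<in> lines" "line_angle L M \<le> b - a" "line_angle L Z = a"
  then show "line_angle Z M \<le> b"
    using line_angle_triangle[of Z L M] line_angle_commute[of Z L] assms by auto
next
  assume *: "\<forall>Z\<in>lines. line_angle L Z = a \<longrightarrow> line_angle Z M \<le> b"
  define t where "t = line_angle L M"
  have t: "0 \<le> t" "t \<le> pi / 2"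
    using line_angle_bounds assms by (auto simp: t_def)
  have "\<exists>Z\<in>lines. line_angle L Z = a \<and> line_angle Z M = min (t + a) (pi / 2)"
    by (subst line_triangle_iff) (use t assms in \<open>auto simp: t_def min_def\<close>)
  then have "min (t + a) (pi / 2) \<le> b"
    using * by metis
  then show "line_angle L M \<le> b - a"
    using assms by (auto simp: t_def min_def split: if_splits)
qed

lemma line_ball_subset_ball_iff:
  fixes L M :: "'a set"
  assumes "L \<in> lines" "M \<in> lines" "0 \<le> a" "a \<le> b" "b < pi / 2"
  shows "line_angle L M \<le> b - a \<longleftrightarrow>
    (\<forall>Z\<in>lines. line_angle L Z \<le> a \<longrightarrow> line_angle Z M \<le> b)"
proof (rule iffI, intro ballI impI)
  fix Z :: "'a set"
  assume "Z \<in> lines" "line_angle L M \<le> b - a" "line_angle L Z \<le> a"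
  then show "line_angle Z M \<le> b"
    using line_angle_triangle[of Z L M] line_angle_commute[of Z L] assms by auto
next
  assume "\<forall>Z\<in>lines. line_angle L Z \<le> a \<longrightarrow> line_angle Z M \<le> b"
  then show "line_angle L M \<le> b - a"
    using line_sphere_subset_ball_iff[OF assms] by auto
qed

text \<open>Recovers the closed relation from the strict one, which is what the case of \<pi>/4
  provides. By midpoints, the right-hand side says that the open ball of radius \<open>a\<close>
  around \<open>L\<close> lies in the open ball of radius \<open>2 * a\<close> around
  \<open>M\<close>.\<close>

lemma line_angle_le_iff_strict:
  fixes L M :: "'a set"
  assumes "L \<in> lines" "M \<in> lines" "0 < a" "a < pi / 4"
  shows "line_angle L M \<le> a \<longleftrightarrow>
    (\<forall>Z\<in>lines. line_angle L Z < a \<longrightarrow>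
      (\<exists>Y\<in>lines. line_angle Z Y < a \<and> line_angle Y M < a))"
proof (rule iffI, intro ballI impI)
  fix Z :: "'a set"
  assume Z: "Z \<in> lines" "line_angle L M \<le> a" "line_angle L Z < a"
  define s where "s = line_angle Z M"
  have s: "s < 2 * a" "0 \<le> s" "s \<le> pi / 2"
    using line_angle_triangle[of Z L M] line_angle_commute[of Z L] assms Z
      line_angle_bounds[of Z M] by (auto simp: s_def)
  have "\<exists>Y\<in>lines. line_angle Z Y = s / 2 \<and> line_angle Y M = s / 2"
    by (subst line_triangle_iff) (use s assms Z in \<open>auto simp: s_def\<close>)
  moreover have "s / 2 < a"
    using s by simp
  ultimately show "\<exists>Y\<in>lines. line_angle Z Y < a \<and> line_angle Y M < a"
    by metis
next
  assume *: "\<forall>Z\<in>lines. line_angle L Z < a \<longrightarrow>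
      (\<exists>Y\<in>lines. line_angle Z Y < a \<and> line_angle Y M < a)"
  define t where "t = line_angle L M"
  have t: "0 \<le> t" "t \<le> pi / 2"
    using line_angle_bounds assms by (auto simp: t_def)
  show "line_angle L M \<le> a"
  proof (rule ccontr)
    assume "\<not> line_angle L M \<le> a"
    then have ta: "t > a"
      by (simp add: t_def)
    \<comment> \<open>Small enough that going \<open>a - \<eta>\<close> beyond \<open>L\<close>
      makes sense and ends at angle at least \<open>2 * a\<close> from \<open>M\<close>:
      \<open>\<eta> \<le> t - a\<close> gives \<open>t + (a - \<eta>) \<ge> 2 * a\<close>, and the
      cut-off \<pi>/2 exceeds \<open>2 * a\<close>.\<close>
    define \<eta> where "\<eta> = min a (t - a)"
    have \<eta>: "0 < \<eta>" "\<eta> \<le> a" "\<eta> \<le> t - a"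
      using ta assms by (auto simp: \<eta>_def)
    have "\<exists>Z\<in>lines. line_angle L Z = a - \<eta> \<and> line_angle Z M = min (t + (a - \<eta>)) (pi / 2)"
      by (subst line_triangle_iff) (use t ta \<eta> assms in \<open>auto simp: t_def min_def\<close>)
    then obtain Z where Z: "Z \<in> lines" "line_angle L Z = a - \<eta>"
      "line_angle Z M = min (t + (a - \<eta>)) (pi / 2)"
      by blast
    then obtain Y where "Y \<in> lines" "line_angle Z Y < a" "line_angle Y M < a"
      using * \<eta> by auto
    then have "line_angle Z M < 2 * a"
      using line_angle_triangle[of Z Y M] Z assms by auto
    then show False
      using Z \<eta> assms by auto
  qed
qed

end

text \<open>
  The midpoint of two lines at angle less than \<open>\<pi>/2\<close> is unique, and it is spanned by the
  sum of unit vectors in phase.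
\<close>

lemma midpoint_unique:
  fixes u v z :: "'a::complex_inner"
  assumes u: "norm u = 1" and v: "norm v = 1" and z: "norm z = 1"
    and uv: "cinner u v = complex_of_real (cos (2 * \<delta>))" and \<delta>: "0 \<le> \<delta>" "\<delta> < pi / 4"
    and zu: "cos \<delta> \<le> cmod (cinner z u)" and zv: "cos \<delta> \<le> cmod (cinner z v)"
  shows "\<exists>c. cmod c = 1 \<and> u + v = complex_of_real (2 * cos \<delta>) *\<^sub>C c *\<^sub>C z"
proof -
  have c0: "cos \<delta> > 0" and c2: "cos (2 * \<delta>) > 0"
    using \<delta> by (auto intro!: cos_gt_zero_pi)
  have nz: "cinner z u \<noteq> 0" "cinner z v \<noteq> 0"
    using zu zv c0 by auto
  define a where "a = cnj (sgn (cinner u z))"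
  define b where "b = cnj (sgn (cinner v z))"
  have nz': "cinner u z \<noteq> 0" "cinner v z \<noteq> 0"
    using nz cinner_eq_zero_commute by blast+
  then have ab: "cmod a = 1" "cmod b = 1"
    by (auto simp: a_def b_def norm_sgn)
  have az: "a * cinner u z = cmod (cinner z u)" "b * cinner v z = cmod (cinner z v)"
  proof -
    have "cnj (sgn w) * w = complex_of_real (cmod w)" for w :: complex
      by (cases "w = 0") (simp_all add: sgn_eq complex_norm_square [symmetric] power2_eq_square
          field_simps)
    then show "a * cinner u z = cmod (cinner z u)" "b * cinner v z = cmod (cinner z v)"
      using cmod_cinner_commute by (metis a_def, metis b_def)
  qed
  \<comment> \<open>The phases make both summands of \<open>cinner w z\<close> nonnegative, so it is
    at least \<open>2 * cos \<delta>\<close>. But \<open>norm w\<close> is at most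
    \<open>2 * cos \<delta>\<close>, so Cauchy-Schwarz is an equality; this forces
    \<open>a = b\<close> and makes \<open>w\<close> a multiple of \<open>z\<close>.\<close>
  define w where "w = a *\<^sub>C u + b *\<^sub>C v"
  define r where "r = cmod (cinner z u) + cmod (cinner z v)"
  have wz: "cinner w z = complex_of_real r"
    by (simp add: w_def cinner_simps az r_def)
  have vu: "cinner v u = complex_of_real (cos (2 * \<delta>))"
    by (subst cinner_commute) (simp add: uv)
  have aa: "a * cnj a = 1" "b * cnj b = 1"
    using ab by (simp_all add: complex_norm_square [symmetric])
  have "cinner w w = a * cnj a + b * cnj b + complex_of_real (cos (2 * \<delta>)) * (a * cnj b + cnj (a * cnj b))"
    using u v by (simp add: w_def cinner_simps uv vu norm_eq_1_iff_cinner algebra_simps)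
  also have "a * cnj b + cnj (a * cnj b) = complex_of_real (2 * Re (a * cnj b))"
    by (rule complex_add_cnj)
  finally have nw: "(norm w)\<^sup>2 = 2 + 2 * cos (2 * \<delta>) * Re (a * cnj b)"
    by (simp add: norm_sq_eq_Re_cinner aa)
  have le1: "Re (a * cnj b) \<le> 1"
    using complex_Re_le_cmod[of "a * cnj b"] ab by (simp add: norm_mult)
  have "(2 * cos \<delta>)\<^sup>2 \<le> r\<^sup>2"
    using zu zv c0 by (intro power_mono) (auto simp: r_def)
  moreover have res: "(norm (w - complex_of_real r *\<^sub>C z))\<^sup>2 = (norm w)\<^sup>2 - r\<^sup>2"
    using norm_residual[OF z, of w] by (simp add: wz)
  moreover have four: "(2 * cos \<delta>)\<^sup>2 = 2 + 2 * cos (2 * \<delta>)"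
    by (simp add: cos_double_cos power2_eq_square)
  ultimately have "2 + 2 * cos (2 * \<delta>) \<le> 2 + 2 * cos (2 * \<delta>) * Re (a * cnj b)"
    using nw zero_le_power2[of "norm (w - complex_of_real r *\<^sub>C z)"] by linarith
  then have re1: "Re (a * cnj b) = 1"
    using le1 c2 by simp
  then have "a * cnj b = 1"
    using ab cmod_power2[of "a * cnj b"] by (intro complex_eqI) (simp_all add: norm_mult)
  then have eq: "a = b"
    using aa by (metis mult.commute mult.assoc mult_1)
  have r: "r = 2 * cos \<delta>" "w = complex_of_real r *\<^sub>C z"
  proof -
    have "r\<^sup>2 \<le> (2 * cos \<delta>)\<^sup>2"
      using res nw re1 four zero_le_power2[of "norm (w - complex_of_real r *\<^sub>C z)"] by simp
    then have r2: "r\<^sup>2 = (2 * cos \<delta>)\<^sup>2"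
      using \<open>(2 * cos \<delta>)\<^sup>2 \<le> r\<^sup>2\<close> by simp
    then show "r = 2 * cos \<delta>"
      using c0 by (subst (asm) power2_eq_iff_nonneg) (auto simp: r_def)
    show "w = complex_of_real r *\<^sub>C z"
      using res nw re1 four r2 by simp
  qed
  have "u + v = (cnj a * a) *\<^sub>C (u + v)"
    using aa by (simp add: mult.commute scaleC_one)
  also have "\<dots> = cnj a *\<^sub>C w"
    unfolding w_def eq by (simp add: scaleC_scaleC scaleC_add_right)
  also have "\<dots> = complex_of_real (2 * cos \<delta>) *\<^sub>C cnj a *\<^sub>C z"
    unfolding r by (simp add: scaleC_scaleC mult.commute)
  finally show ?thesis
    using ab by (intro exI[of _ "cnj a"]) simp
qed

subsection \<open>From small angles to isometry\<close>

context
  assumes dim3: "cdim_at_least 3 TYPE('a::complex_inner)"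
begin

text \<open>
  On the right-hand side, \<open>m\<close> is forced to be the midpoint of two lines \<open>L\<close>
  and \<open>M\<close> at angle \<open>2\<delta>\<close>. The extremal case is the one where \<open>L\<close> and \<open>M\<close>
  lie in a direction orthogonal to \<open>X\<close>; the cosines of the angles at the right-angled triangle
  \<open>X, m, L\<close> then multiply.
\<close>

lemma median_iff:
  fixes m X :: "'a set"
  assumes mX: "m \<in> lines" "X \<in> lines" and \<delta>: "0 < \<delta>" "\<delta> < pi / 4"
  shows "cos (2 * \<delta>) \<le> cos \<delta> * cos (line_angle m X) \<longleftrightarrow>
    (\<forall>L\<in>lines. \<forall>M\<in>lines.
      (\<forall>Z\<in>lines. line_angle L Z \<le> \<delta> \<and> line_angle M Z \<le> \<delta> \<longleftrightarrow> Z = m) \<longrightarrow>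
      line_angle X L \<le> 2 * \<delta> \<or> line_angle X M \<le> 2 * \<delta>)" (is "?l \<longleftrightarrow> ?r")
proof -
  obtain z x where z: "norm z = 1" "m = line_through z" and x: "norm x = 1" "X = line_through x"
    using mX by (metis lines_unitE)
  have c0: "cos \<delta> > 0"
    using \<delta> by (auto intro!: cos_gt_zero_pi)
  have cmX: "cos (line_angle m X) = cmod (cinner x z)"
    using z x by (simp add: cos_line_angle_unit cmod_cinner_commute)
  show ?thesis
  proof
    assume l: ?l
    show ?r
    proof (intro ballI impI)
      fix L M :: "'a set"
      assume LM: "L \<in> lines" "M \<in> lines"
        and uniq: "\<forall>Z\<in>lines. line_angle L Z \<le> \<delta> \<and> line_angle M Z \<le> \<delta> \<longleftrightarrow> Z = m"
      obtain u f g t where on: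
        "norm u = 1" "norm f = 1" "norm g = 1" "cinner u f = 0" "cinner u g = 0" "cinner f g = 0"
        and t: "t = line_angle L M" "0 \<le> t" "t \<le> pi / 2"
        and L: "L = line_through u"
        and M: "M = line_through (complex_of_real (cos t) *\<^sub>C u + complex_of_real (sin t) *\<^sub>C f + 0 *\<^sub>C g)"
        using lines_orthonormalE[OF dim3 LM] by metis
      define v where "v = complex_of_real (cos t) *\<^sub>C u + complex_of_real (sin t) *\<^sub>C f + 0 *\<^sub>C g"
      have v: "norm v = 1"
        unfolding v_def by (intro norm_orthonormal_eq_1 on) simp
      have uv: "cinner u v = complex_of_real (cos t)"
        using on by (simp add: v_def cinner_simps norm_eq_1_iff_cinner)
      have Lm: "line_angle L m \<le> \<delta>" "line_angle M m \<le> \<delta>"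
        using uniq mX by auto
      have "t \<le> 2 * \<delta>"
        using line_angle_triangle[of L m M] line_angle_commute[of m M] LM mX Lm t by simp
      \<comment> \<open>If \<open>L\<close> and \<open>M\<close> were closer, there would be
        equidistant lines at every angle from \<open>t / 2\<close> to \<open>\<delta>\<close>,
        against uniqueness of \<open>m\<close>.\<close>
      moreover have "\<not> t < 2 * \<delta>"
      proof
        assume less: "t < 2 * \<delta>"
        have mid: "\<exists>Z\<in>lines. line_angle L Z = s \<and> line_angle Z M = s"
          if "t / 2 \<le> s" "s \<le> \<delta>" for s
          by (subst line_triangle_iff[OF dim3 LM]) (use that t \<delta> in auto)
        have "line_angle L m = s" if s: "t / 2 \<le> s" "s \<le> \<delta>" for s
        proof -
          obtain Z where "Z \<in> lines" "line_angle L Z = s" "line_angle Z M = s"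
            using mid[OF s] by blast
          moreover from this have "Z = m"
            using uniq s LM line_angle_commute by metis
          ultimately show ?thesis
            by simp
        qed
        from this[of "t / 2"] this[of \<delta>] show False
          using less by simp
      qed
      ultimately have t2: "t = 2 * \<delta>"
        by simp
      have "cos \<delta> \<le> cmod (cinner z u)" "cos \<delta> \<le> cmod (cinner z v)"
        using Lm \<delta> on(1) v z(1) unfolding L M z(2) v_def [symmetric]
        by (simp_all add: line_angle_unit_le_iff cmod_cinner_commute[of z])
      then obtain c where c: "cmod c = 1" "u + v = complex_of_real (2 * cos \<delta>) *\<^sub>C c *\<^sub>C z"
        using midpoint_unique[of u v z \<delta>] on v z uv t2 \<delta> by auto
      \<comment> \<open>The overlaps of \<open>x\<close> with \<open>u\<close> and \<open>v\<close>
        have mean at least \<open>cos \<delta> * cmod (cinner x z)\<close>, hence at least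
        \<open>cos (2 * \<delta>)\<close> by \<open>l\<close>; so one of them reaches that
        value.\<close>
      have "2 * cos \<delta> * cmod (cinner x z) = cmod (cinner x (u + v))"
        unfolding c(2) using c(1) c0 by (simp add: cinner_scaleC_right norm_mult)
      also have "\<dots> \<le> cmod (cinner x u) + cmod (cinner x v)"
        by (simp add: cinner_add_right norm_triangle_ineq)
      finally have "cos (2 * \<delta>) \<le> cmod (cinner x u) \<or> cos (2 * \<delta>) \<le> cmod (cinner x v)"
        using l unfolding cmX by linarith
      then show "line_angle X L \<le> 2 * \<delta> \<or> line_angle X M \<le> 2 * \<delta>"
        unfolding L M v_def [symmetric] x(2)
        using on v x \<delta> by (subst (1 2) line_angle_unit_le_iff) auto
    qed
  next
    assume r: ?r
    obtain e :: 'a where e: "norm e = 1" "cinner e z = 0" "cinner e x = 0"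
      using orthogonal_unit_vector[OF dim3] by metis
    then have e': "cinner z e = 0" "cinner x e = 0"
      by (simp_all add: cinner_eq_zero_commute)
    \<comment> \<open>Two lines at angle \<open>2 * \<delta>\<close> symmetric about
      \<open>m\<close>. As \<open>e\<close> is orthogonal to \<open>x\<close>, they have the same
      overlap with \<open>x\<close>, so the disjunction in \<open>r\<close> gives the bound either
      way.\<close>
    define u where "u = complex_of_real (cos \<delta>) *\<^sub>C z + complex_of_real (sin \<delta>) *\<^sub>C e"
    define v where "v = complex_of_real (cos \<delta>) *\<^sub>C z - complex_of_real (sin \<delta>) *\<^sub>C e"
    have sc: "complex_of_real (cos \<delta>) * complex_of_real (cos \<delta>) +
        complex_of_real (sin \<delta>) * complex_of_real (sin \<delta>) = 1"
      using sin_cos_squared_add3[of \<delta>] by (metis of_real_1 of_real_add of_real_mult)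
    have uv1: "norm u = 1" "norm v = 1"
      using z e e' sc by (simp_all add: norm_eq_1_iff_cinner u_def v_def cinner_simps)
    have uv: "cinner u v = complex_of_real (cos (2 * \<delta>))"
      using z e e' by (simp add: norm_eq_1_iff_cinner u_def v_def cinner_simps cos_double power2_eq_square)
    have zu: "cinner z u = cos \<delta>" "cinner z v = cos \<delta>"
      using z e' by (simp_all add: norm_eq_1_iff_cinner u_def v_def cinner_simps)
    have xu: "cmod (cinner x u) = cos \<delta> * cmod (cinner x z)" "cmod (cinner x v) = cos \<delta> * cmod (cinner x z)"
      using e' c0 by (simp_all add: u_def v_def cinner_simps norm_mult)
    have "line_angle (line_through u) Z \<le> \<delta> \<and> line_angle (line_through v) Z \<le> \<delta> \<longleftrightarrow> Z = m"
      if "Z \<in> lines" for Z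
    proof
      assume Z: "line_angle (line_through u) Z \<le> \<delta> \<and> line_angle (line_through v) Z \<le> \<delta>"
      obtain y where y: "norm y = 1" "Z = line_through y"
        using \<open>Z \<in> lines\<close> by (rule lines_unitE)
      have "cos \<delta> \<le> cmod (cinner y u)" "cos \<delta> \<le> cmod (cinner y v)"
        using Z \<delta> uv1 y by (simp_all add: line_angle_unit_le_iff cmod_cinner_commute[of y])
      then obtain c where c: "cmod c = 1" "u + v = complex_of_real (2 * cos \<delta>) *\<^sub>C c *\<^sub>C y"
        using midpoint_unique[of u v y \<delta>] uv uv1 y \<delta> by auto
      have "u + v = complex_of_real (2 * cos \<delta>) *\<^sub>C z"
        unfolding mult_2 of_real_add scaleC_add_left by (simp add: u_def v_def)
      moreover have "complex_of_real (2 * cos \<delta>) \<noteq> 0"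
        using c0 by simp
      ultimately have "z = c *\<^sub>C y"
        using c(2) complex_vector.scale_left_imp_eq by metis
      then show "Z = m"
        using y z c(1) line_through_scaleC by (metis norm_zero zero_neq_one)
    next
      assume "Z = m"
      then show "line_angle (line_through u) Z \<le> \<delta> \<and> line_angle (line_through v) Z \<le> \<delta>"
        using uv1 z \<delta> c0 zu by (simp add: line_angle_unit_le_iff cmod_cinner_commute[of _ z])
    qed
    then have "line_angle X (line_through u) \<le> 2 * \<delta> \<or> line_angle X (line_through v) \<le> 2 * \<delta>"
      using r uv1 by simp
    then have "cos (2 * \<delta>) \<le> cos \<delta> * cmod (cinner x z)"
      using x(1) uv1 \<delta> unfolding x(2) by (simp add: line_angle_unit_le_iff xu)
    then show ?l
      unfolding cmX .
  qed
qed

end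

section \<open>Transport of angle relations along the bijection\<close>

context
  fixes \<phi> :: "'a::complex_inner set \<Rightarrow> 'a set"
  assumes dim3: "cdim_at_least 3 TYPE('a)"
    and bij: "bij_betw \<phi> lines lines"
begin

definition preserves_angle_le :: "real \<Rightarrow> bool" where
  "preserves_angle_le a \<longleftrightarrow>
    (\<forall>L\<in>lines. \<forall>M\<in>lines. line_angle (\<phi> L) (\<phi> M) \<le> a \<longleftrightarrow> line_angle L M \<le> a)"

lemma phi_lines [simp]: "L \<in> lines \<Longrightarrow> \<phi> L \<in> lines"
  using bij by (auto simp: bij_betw_def)

lemma phi_eq_iff [simp]: "L \<in> lines \<Longrightarrow> M \<in> lines \<Longrightarrow> \<phi> L = \<phi> M \<longleftrightarrow> L = M"
  using bij by (auto simp: bij_betw_def inj_on_def)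

text \<open>Surjectivity lets a bound line be replaced by an image. So conditions quantified over
  lines and built from preserved relations are preserved themselves.\<close>

lemma ball_lines_cong:
  assumes "\<And>L. L \<in> lines \<Longrightarrow> P (\<phi> L) \<longleftrightarrow> Q L"
  shows "(\<forall>L\<in>lines. P L) \<longleftrightarrow> (\<forall>L\<in>lines. Q L)"
proof -
  have "(\<forall>L\<in>\<phi> ` lines. P L) \<longleftrightarrow> (\<forall>L\<in>lines. Q L)"
    using assms by simp
  moreover have "\<phi> ` lines = lines"
    using bij by (simp add: bij_betw_def)
  ultimately show ?thesis
    by (simp only:)
qed

lemma bex_lines_cong:
  assumes "\<And>L. L \<in> lines \<Longrightarrow> P (\<phi> L) \<longleftrightarrow> Q L"
  shows "(\<exists>L\<in>lines. P L) \<longleftrightarrow> (\<exists>L\<in>lines. Q L)"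
  using ball_lines_cong[of "\<lambda>L. \<not> P L" "\<lambda>L. \<not> Q L"] assms by blast

lemma preserves_angle_le_add:
  assumes "preserves_angle_le a" "preserves_angle_le b" "0 \<le> a" "0 \<le> b"
  shows "preserves_angle_le (a + b)"
  unfolding preserves_angle_le_def
proof (intro ballI)
  fix L M :: "'a set"
  assume LM: "L \<in> lines" "M \<in> lines"
  have "line_angle (\<phi> L) (\<phi> M) \<le> a + b \<longleftrightarrow>
      (\<exists>Z\<in>lines. line_angle (\<phi> L) Z \<le> a \<and> line_angle Z (\<phi> M) \<le> b)"
    using LM assms by (subst line_angle_le_add_iff[OF dim3]) simp_all
  also have "\<dots> \<longleftrightarrow> (\<exists>Z\<in>lines. line_angle L Z \<le> a \<and> line_angle Z M \<le> b)"
    by (rule bex_lines_cong) (use LM assms in \<open>auto simp: preserves_angle_le_def\<close>)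
  also have "\<dots> \<longleftrightarrow> line_angle L M \<le> a + b"
    using LM assms by (subst line_angle_le_add_iff[OF dim3]) simp_all
  finally show "line_angle (\<phi> L) (\<phi> M) \<le> a + b \<longleftrightarrow> line_angle L M \<le> a + b" .
qed

lemma preserves_angle_le_diff:
  assumes "preserves_angle_le a" "preserves_angle_le b" "0 \<le> a" "a \<le> b" "b < pi / 2"
  shows "preserves_angle_le (b - a)"
  unfolding preserves_angle_le_def
proof (intro ballI)
  fix L M :: "'a set"
  assume LM: "L \<in> lines" "M \<in> lines"
  have "line_angle (\<phi> L) (\<phi> M) \<le> b - a \<longleftrightarrow>
      (\<forall>Z\<in>lines. line_angle (\<phi> L) Z \<le> a \<longrightarrow> line_angle Z (\<phi> M) \<le> b)"
    using LM assms by (subst line_ball_subset_ball_iff[OF dim3]) simp_all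
  also have "\<dots> \<longleftrightarrow> (\<forall>Z\<in>lines. line_angle L Z \<le> a \<longrightarrow> line_angle Z M \<le> b)"
    by (rule ball_lines_cong) (use LM assms in \<open>auto simp: preserves_angle_le_def\<close>)
  also have "\<dots> \<longleftrightarrow> line_angle L M \<le> b - a"
    using LM assms by (subst line_ball_subset_ball_iff[OF dim3]) simp_all
  finally show "line_angle (\<phi> L) (\<phi> M) \<le> b - a \<longleftrightarrow> line_angle L M \<le> b - a" .
qed

lemma preserves_angle_le_half:
  assumes pres: "preserves_angle_le \<delta>" and \<delta>: "0 < \<delta>" "\<delta> < pi / 4"
  shows "\<exists>\<delta>'. preserves_angle_le \<delta>' \<and> 0 < \<delta>' \<and> \<delta>' \<le> \<delta> / 2"
proof -
  have pres2: "preserves_angle_le (2 * \<delta>)"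
    using preserves_angle_le_add[OF pres pres] \<delta> by simp
  have cs: "0 < cos (2 * \<delta>)" "cos (2 * \<delta>) < cos \<delta>" "0 < cos \<delta>" "cos \<delta> < 1"
    using \<delta> cos_monotone_0_pi[of 0 \<delta>] by (auto intro!: cos_gt_zero_pi cos_monotone_0_pi)
  define h where "h = arccos (cos (2 * \<delta>) / cos \<delta>)"
  have q: "0 \<le> cos (2 * \<delta>) / cos \<delta>" "cos (2 * \<delta>) / cos \<delta> \<le> 1"
    using cs by (auto simp: field_simps)
  have h: "0 \<le> h" "h \<le> pi / 2" and ch: "cos h = cos (2 * \<delta>) / cos \<delta>"
    using q arccos_lbound[of "cos (2 * \<delta>) / cos \<delta>"] arccos_le_pi2[OF q] by (auto simp: h_def cos_arccos)
  have char: "line_angle m X \<le> h \<longleftrightarrow> cos (2 * \<delta>) \<le> cos \<delta> * cos (line_angle m X)"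
    if "m \<in> lines" "X \<in> lines" for m X :: "'a set"
    using that h cs by (simp add: line_angle_le_iff_cos ch field_simps)
  have presh: "preserves_angle_le h"
    unfolding preserves_angle_le_def
  proof (intro ballI)
    fix m X :: "'a set"
    assume mX: "m \<in> lines" "X \<in> lines"
    have "line_angle (\<phi> m) (\<phi> X) \<le> h \<longleftrightarrow>
      (\<forall>L\<in>lines. \<forall>M\<in>lines.
        (\<forall>Z\<in>lines. line_angle L Z \<le> \<delta> \<and> line_angle M Z \<le> \<delta> \<longleftrightarrow> Z = \<phi> m) \<longrightarrow>
        line_angle (\<phi> X) L \<le> 2 * \<delta> \<or> line_angle (\<phi> X) M \<le> 2 * \<delta>)"
      using mX by (simp only: char phi_lines median_iff[OF dim3 _ _ \<delta>])
    also have "\<dots> \<longleftrightarrow> (\<forall>L\<in>lines. \<forall>M\<in>lines.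
        (\<forall>Z\<in>lines. line_angle L Z \<le> \<delta> \<and> line_angle M Z \<le> \<delta> \<longleftrightarrow> Z = m) \<longrightarrow>
        line_angle X L \<le> 2 * \<delta> \<or> line_angle X M \<le> 2 * \<delta>)"
    proof (intro ball_lines_cong)
      fix L M :: "'a set"
      assume LM: "L \<in> lines" "M \<in> lines"
      have "(\<forall>Z\<in>lines. line_angle (\<phi> L) Z \<le> \<delta> \<and> line_angle (\<phi> M) Z \<le> \<delta> \<longleftrightarrow> Z = \<phi> m) \<longleftrightarrow>
          (\<forall>Z\<in>lines. line_angle L Z \<le> \<delta> \<and> line_angle M Z \<le> \<delta> \<longleftrightarrow> Z = m)"
        by (rule ball_lines_cong) (use LM mX pres in \<open>simp add: preserves_angle_le_def\<close>)
      moreover have "line_angle (\<phi> X) (\<phi> N) \<le> 2 * \<delta> \<longleftrightarrow> line_angle X N \<le> 2 * \<delta>" if "N \<in> lines" for N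
        using pres2 mX that unfolding preserves_angle_le_def by blast
      ultimately show "((\<forall>Z\<in>lines. line_angle (\<phi> L) Z \<le> \<delta> \<and> line_angle (\<phi> M) Z \<le> \<delta> \<longleftrightarrow> Z = \<phi> m) \<longrightarrow>
          line_angle (\<phi> X) (\<phi> L) \<le> 2 * \<delta> \<or> line_angle (\<phi> X) (\<phi> M) \<le> 2 * \<delta>) \<longleftrightarrow>
        ((\<forall>Z\<in>lines. line_angle L Z \<le> \<delta> \<and> line_angle M Z \<le> \<delta> \<longleftrightarrow> Z = m) \<longrightarrow>
          line_angle X L \<le> 2 * \<delta> \<or> line_angle X M \<le> 2 * \<delta>)"
        using LM by (simp only:)
    qed
    also have "\<dots> \<longleftrightarrow> line_angle m X \<le> h"
      using mX by (simp only: char median_iff[OF dim3 _ _ \<delta>])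
    finally show "line_angle (\<phi> m) (\<phi> X) \<le> h \<longleftrightarrow> line_angle m X \<le> h" .
  qed
  have "cos h < cos \<delta>"
  proof -
    have "cos (2 * \<delta>) < (cos \<delta>)\<^sup>2"
      using \<delta> sin_gt_zero[of \<delta>] by (simp add: cos_double)
    then show ?thesis
      using cs by (simp add: ch field_simps power2_eq_square)
  qed
  then have h1: "\<delta> < h"
    using h \<delta> by (subst (asm) cos_mono_less_eq) auto
  have "cos (2 * \<delta>) < cos h"
    using cs by (simp add: ch field_simps)
  then have h2: "h < 2 * \<delta>"
    using h \<delta> by (subst (asm) cos_mono_less_eq) auto
  have "preserves_angle_le (h - \<delta>)" "preserves_angle_le (2 * \<delta> - h)"
    using preserves_angle_le_diff pres presh pres2 h1 h2 \<delta> by auto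
  then show ?thesis
    using h1 h2 by (cases "h - \<delta> \<le> \<delta> / 2") (auto intro: exI[of _ "h - \<delta>"] exI[of _ "2 * \<delta> - h"])
qed

lemma preserves_angle_le_small:
  assumes "preserves_angle_le \<delta>" "0 < \<delta>" "\<delta> < pi / 4" "0 < \<epsilon>"
  shows "\<exists>\<delta>'. preserves_angle_le \<delta>' \<and> 0 < \<delta>' \<and> \<delta>' < \<epsilon>"
proof -
  have "\<exists>\<delta>'. preserves_angle_le \<delta>' \<and> 0 < \<delta>' \<and> \<delta>' \<le> \<delta> / 2 ^ n" for n
  proof (induction n)
    case 0
    then show ?case
      using assms by auto
  next
    case (Suc n)
    then obtain d where d: "preserves_angle_le d" "0 < d" "d \<le> \<delta> / 2 ^ n"
      by blast
    \<comment> \<open>Keeps \<open>d\<close> below \<pi>/4, where halving applies again.\<close>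
    have "\<delta> / 2 ^ n \<le> \<delta>"
      using assms by (simp add: field_simps)
    then obtain d' where "preserves_angle_le d'" "0 < d'" "d' \<le> d / 2"
      using preserves_angle_le_half[of d] d assms by auto
    moreover have "d / 2 \<le> \<delta> / 2 ^ Suc n"
      using d by simp
    ultimately show ?case
      by (meson order_trans)
  qed
  moreover obtain n where "\<delta> / 2 ^ n < \<epsilon>"
  proof -
    obtain n where "(1 / 2) ^ n < \<epsilon> / \<delta>"
      using real_arch_pow_inv[of "\<epsilon> / \<delta>" "1 / 2"] assms by auto
    then show thesis
      using that[of n] assms by (simp add: field_simps power_one_over)
  qed
  ultimately show ?thesis
    by (meson le_less_trans)
qed

lemma preserves_angle_le_mult:
  assumes "preserves_angle_le \<delta>" "0 < \<delta>"
  shows "preserves_angle_le (real (Suc n) * \<delta>)"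
proof (induction n)
  case (Suc n)
  have "preserves_angle_le (\<delta> + real (Suc n) * \<delta>)"
    using Suc assms by (intro preserves_angle_le_add) auto
  then show ?case
    by (simp add: algebra_simps)
qed (simp add: assms)

text \<open>All multiples of an arbitrarily small preserved radius are preserved, so comparing with
  them determines the angle up to any \<open>\<epsilon>\<close>.\<close>

lemma preserves_line_angle:
  assumes pres: "preserves_angle_le \<delta>" "0 < \<delta>" "\<delta> < pi / 4"
    and LM: "L \<in> lines" "M \<in> lines"
  shows "line_angle (\<phi> L) (\<phi> M) = line_angle L M"
proof -
  have "line_angle (\<phi> L) (\<phi> M) \<le> line_angle L M + \<epsilon> \<and> line_angle L M \<le> line_angle (\<phi> L) (\<phi> M) + \<epsilon>"
    if "0 < \<epsilon>" for \<epsilon>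
  proof -
    obtain d where d: "preserves_angle_le d" "0 < d" "d < \<epsilon>"
      using preserves_angle_le_small[OF pres \<open>0 < \<epsilon>\<close>] by blast
    have "\<exists>n. s \<le> real (Suc n) * d \<and> real (Suc n) * d \<le> s + \<epsilon>" if "0 \<le> s" for s
    \<comment> \<open>With this \<open>n\<close>, the number \<open>real (Suc n) * d\<close> is the
      first multiple of \<open>d\<close> strictly above \<open>s\<close>, so it overshoots by at
      most \<open>d\<close>.\<close>
    proof (intro exI[of _ "nat \<lfloor>s / d\<rfloor>"] conjI)
      have "0 \<le> s / d"
        using that d by simp
      then have n: "real (nat \<lfloor>s / d\<rfloor>) \<le> s / d" "s / d < real (nat \<lfloor>s / d\<rfloor>) + 1"
        by linarith+
      then have "real (nat \<lfloor>s / d\<rfloor>) * d \<le> s" "s < (real (nat \<lfloor>s / d\<rfloor>) + 1) * d"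
        using d by (simp_all add: field_simps)
      then show "s \<le> real (Suc (nat \<lfloor>s / d\<rfloor>)) * d" "real (Suc (nat \<lfloor>s / d\<rfloor>)) * d \<le> s + \<epsilon>"
        using d by (simp_all add: algebra_simps)
    qed
    note n = this
    have "line_angle (\<phi> L) (\<phi> M) \<le> real (Suc n) * d \<longleftrightarrow> line_angle L M \<le> real (Suc n) * d" for n
      using preserves_angle_le_mult[OF d(1,2), of n] LM unfolding preserves_angle_le_def by blast
    then show ?thesis
      using n[of "line_angle L M"] n[of "line_angle (\<phi> L) (\<phi> M)"] line_angle_bounds(1) LM phi_lines
      by (meson order_trans)
  qed
  note close = this
  show ?thesis
    by (rule antisym; rule field_le_epsilon) (simp_all add: close)
qed

text \<open>Since \<open>2 * \<alpha> < pi / 2\<close>, \<open>line_sphere_subset_ball_iff\<close>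
  applies with radii \<open>\<alpha>\<close> and \<open>2 * \<alpha>\<close>; common neighbours
  express the larger radius through equality with \<open>\<alpha>\<close>.\<close>

lemma preserves_angle_le_of_eq:
  assumes \<alpha>: "0 < \<alpha>" "\<alpha> < pi / 4"
    and eq: "\<And>L M. L \<in> lines \<Longrightarrow> M \<in> lines \<Longrightarrow>
      line_angle (\<phi> L) (\<phi> M) = \<alpha> \<longleftrightarrow> line_angle L M = \<alpha>"
  shows "preserves_angle_le \<alpha>"
proof -
  have two: "line_angle L M \<le> 2 * \<alpha> \<longleftrightarrow>
      (\<exists>Z\<in>lines. line_angle L Z = \<alpha> \<and> line_angle Z M = \<alpha>)"
    if "L \<in> lines" "M \<in> lines" for L M :: "'a set"
    using \<alpha> that line_angle_bounds[OF that] by (subst line_triangle_iff[OF dim3]) auto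
  have pres2: "line_angle (\<phi> L) (\<phi> M) \<le> 2 * \<alpha> \<longleftrightarrow> line_angle L M \<le> 2 * \<alpha>"
    if "L \<in> lines" "M \<in> lines" for L M
    unfolding two[OF that] two[OF that [THEN phi_lines]]
    by (rule bex_lines_cong) (use that eq in simp)
  have one: "line_angle L M \<le> \<alpha> \<longleftrightarrow>
      (\<forall>Z\<in>lines. line_angle L Z = \<alpha> \<longrightarrow> line_angle Z M \<le> 2 * \<alpha>)"
    if "L \<in> lines" "M \<in> lines" for L M :: "'a set"
    using line_sphere_subset_ball_iff[OF dim3 that, of \<alpha> "2 * \<alpha>"] \<alpha> by simp
  show ?thesis
    unfolding preserves_angle_le_def
  proof (intro ballI)
    fix L M :: "'a set"
    assume LM: "L \<in> lines" "M \<in> lines"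
    show "line_angle (\<phi> L) (\<phi> M) \<le> \<alpha> \<longleftrightarrow> line_angle L M \<le> \<alpha>"
      unfolding one[OF LM] one[OF LM [THEN phi_lines]]
      by (rule ball_lines_cong) (use LM eq pres2 in simp)
  qed
qed

end

subsection \<open>Wigner's theorem\<close>

text \<open>The defect \<open>d\<close> is orthogonal to every \<open>T z\<close> with
  \<open>z\<close> in \<open>S\<close>, and it is itself a combination of three such vectors, so it
  is 0.\<close>

lemma real_inner_preserving_additive:
  fixes T :: "'a::real_inner \<Rightarrow> 'a"
  assumes "\<And>x y. x \<in> S \<Longrightarrow> y \<in> S \<Longrightarrow> inner (T x) (T y) = inner x y"
    and "x \<in> S" "y \<in> S" "a *\<^sub>R x + b *\<^sub>R y \<in> S"
  shows "T (a *\<^sub>R x + b *\<^sub>R y) = a *\<^sub>R T x + b *\<^sub>R T y"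
proof -
  define w where "w = a *\<^sub>R x + b *\<^sub>R y"
  define d where "d = T w - a *\<^sub>R T x - b *\<^sub>R T y"
  have d: "inner d (T z) = 0" if "z \<in> S" for z
  proof -
    have "inner d (T z) = inner w z - a * inner x z - b * inner y z"
      using assms that by (simp add: d_def w_def inner_diff_left)
    then show ?thesis
      by (simp add: w_def inner_add_left)
  qed
  have "inner d d = 0"
    using d assms by (subst (2) d_def) (simp add: inner_diff_right w_def)
  then have "d = 0"
    by simp
  then show ?thesis
    by (simp add: d_def w_def diff_diff_eq)
qed

lemma scaleC_Re_Im: "c *\<^sub>C x = Re c *\<^sub>R x + Im c *\<^sub>R \<i> *\<^sub>C x"
  for x :: "'a::complex_inner"
proof -
  have "c = complex_of_real (Re c) + complex_of_real (Im c) * \<i>"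
    by (simp add: complex_eq mult.commute)
  then show ?thesis
    unfolding scaleR_scaleC scaleC_scaleC scaleC_add_left [symmetric] by simp
qed

lemma inner_i_scaleC_self: "inner x (\<i> *\<^sub>C x) = 0"
  for x :: "'a::complex_inner"
  by (simp add: inner_eq_Re_cinner cinner_simps cinner_self)

lemma cmod_cinner_eq_norm_multD:
  fixes x z :: "'a::complex_inner"
  assumes "cmod (cinner x z) = norm x * norm z" "z \<noteq> 0"
  shows "\<exists>c. x = c *\<^sub>C z"
proof -
  define z' where "z' = complex_of_real (1 / norm z) *\<^sub>C z"
  have z': "norm z' = 1"
    using assms by (simp add: z'_def norm_scaleC norm_divide)
  have "cmod (cinner x z') = norm x"
    using assms by (simp add: z'_def cinner_simps norm_mult norm_divide)
  then have "x = cinner x z' *\<^sub>C z'"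
    using norm_residual[OF z', of x] by simp
  then show ?thesis
    by (metis z'_def scaleC_scaleC)
qed

text \<open>Covers both the linear (\<open>\<sigma> = id\<close>) and the conjugate-linear (\<open>\<sigma> = cnj\<close>) case.\<close>

lemma Wigner_symmetryI:
  fixes \<phi> :: "'a::complex_inner set \<Rightarrow> 'a set"
  assumes \<sigma>: "\<sigma> = (\<lambda>c. c) \<or> \<sigma> = cnj"
    and add: "\<And>x y. U (x + y) = U x + U y"
    and scale: "\<And>c x. U (c *\<^sub>C x) = \<sigma> c *\<^sub>C U x"
    and norm: "\<And>x. norm (U x) = norm x"
    and \<phi>: "\<And>v. v \<noteq> 0 \<Longrightarrow> \<phi> (line_through v) = line_through (U v)"
    and surj: "lines \<subseteq> \<phi> ` lines"
  shows "Wigner_symmetry \<phi>"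
proof -
  have \<sigma>\<sigma>: "\<sigma> (\<sigma> c) = c" for c
    using \<sigma> by auto
  have diff: "U (x - y) = U x - U y" for x y
    using add[of "x - y" y] by simp
  have dist: "dist (U x) (U y) = dist x y" for x y
    by (simp add: dist_norm norm diff [symmetric])
  have "inj U"
    using dist by (metis dist_eq_0_iff injI)
  moreover have "\<exists>x. U x = y" for y
  proof (cases "y = 0")
    case True
    then show ?thesis
      using norm[of 0] by auto
  next
    case False
    then have "line_through y \<in> \<phi> ` lines"
      using surj by auto
    then obtain x where x: "x \<noteq> 0" "line_through y = line_through (U x)"
      using \<phi> by (auto simp: lines_eq)
    then obtain c where "y = c *\<^sub>C U x"
      using line_through_eqD False by metis
    then have "U (\<sigma> c *\<^sub>C x) = y"
      by (simp add: scale \<sigma>\<sigma>)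
    then show ?thesis
      by blast
  qed
  ultimately have "bij U"
    by (metis bijI surjI surj_def)
  moreover have "Vector_Spaces.linear scaleC scaleC U \<or> conjugate_linear U"
    using \<sigma>
  proof
    assume "\<sigma> = (\<lambda>c. c)"
    then have "Vector_Spaces.linear scaleC scaleC U"
      by unfold_locales (simp_all add: add scale)
    then show ?thesis ..
  qed (simp add: conjugate_linear_def add scale)
  ultimately show ?thesis
    unfolding Wigner_symmetry_def using dist \<phi> by blast
qed

text \<open>
  Bargmann's argument: fix unit vectors \<open>e\<close> and \<open>e'\<close> with \<open>\<phi> [e] = [e']\<close> and
  normalise the image of \<open>[e + z]\<close>, for \<open>z\<close> orthogonal to \<open>e\<close>, to
  \<open>[e' + T z]\<close> with \<open>T z\<close> orthogonal to \<open>e'\<close>.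
\<close>

theorem Wigner:
  fixes \<phi> :: "'a::complex_inner set \<Rightarrow> 'a set"
  assumes bij: "bij_betw \<phi> lines lines"
    and angle: "\<And>L M. L \<in> lines \<Longrightarrow> M \<in> lines \<Longrightarrow> line_angle (\<phi> L) (\<phi> M) = line_angle L M"
    and ex: "\<exists>x::'a. x \<noteq> 0"
  shows "Wigner_symmetry \<phi>"
proof -
  have \<phi>_lines: "\<phi> L \<in> lines" if "L \<in> lines" for L
    using bij that by (auto simp: bij_betw_def)
  have overlap: "cmod (cinner x' y') / (norm x' * norm y') = cmod (cinner x y) / (norm x * norm y)"
    if "x \<noteq> 0" "y \<noteq> 0" "x' \<noteq> 0" "y' \<noteq> 0"
      "\<phi> (line_through x) = line_through x'" "\<phi> (line_through y) = line_through y'" for x y x' y' :: 'a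
  proof -
    have range: "-1 \<le> q \<and> q \<le> 1" if "q = cmod (cinner u v) / (norm u * norm v)" "u \<noteq> 0" "v \<noteq> 0"
      for u v :: 'a and q
      using that cmod_cinner_le[of u v] order_trans[of "- 1" 0 q] by (simp add: divide_le_eq_1)
    have "line_angle (line_through x') (line_through y') = line_angle (line_through x) (line_through y)"
      using angle[of "line_through x" "line_through y"] that by simp
    then have "arccos (cmod (cinner x' y') / (norm x' * norm y')) = arccos (cmod (cinner x y) / (norm x * norm y))"
      using that by (simp add: line_angle_line_through)
    then show ?thesis
      using range[OF refl that(1,2)] range[OF refl that(3,4)] by (metis cos_arccos)
  qed
  obtain x0 :: 'a where "x0 \<noteq> 0"
    using ex by blast
  then obtain e where e: "norm e = (1::real)" "line_through x0 = line_through e"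
    using lines_unitE[of "line_through x0"] by auto
  obtain e' where e': "norm e' = 1" "\<phi> (line_through e) = line_through e'"
    using \<phi>_lines[of "line_through e"] e by (metis lines_unitE line_through_unit_in_lines)
  have e0: "e \<noteq> 0" "e' \<noteq> 0"
    using e e' by auto
  define S where "S = {z. cinner z e = 0}"
  define S' where "S' = {z. cinner z e' = 0}"
  have S_add: "x + y \<in> S" if "x \<in> S" "y \<in> S" for x y
    using that by (simp add: S_def cinner_simps)
  have S_scale: "c *\<^sub>C x \<in> S" if "x \<in> S" for c x
    using that by (simp add: S_def cinner_simps)
  have S_scaleR: "r *\<^sub>R x \<in> S" if "x \<in> S" for r x
    using S_scale that by (simp add: scaleR_scaleC)
  have nz: "e + z \<noteq> 0" if "z \<in> S" for z
    using that e cinner_simps(1)[of e z e] by (auto simp: S_def norm_eq_1_iff_cinner)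
  have nz': "e' + z \<noteq> 0" if "z \<in> S'" for z
    using that e' cinner_simps(1)[of e' z e'] by (auto simp: S'_def norm_eq_1_iff_cinner)
  have cinner_e: "cinner (e + z) (e + w) = 1 + cinner z w" if "z \<in> S" "w \<in> S" for z w
    using that e cinner_eq_zero_commute[of e w] by (simp add: S_def cinner_simps norm_eq_1_iff_cinner)
  have cinner_e': "cinner (e' + z) (e' + w) = 1 + cinner z w" if "z \<in> S'" "w \<in> S'" for z w
    using that e' cinner_eq_zero_commute[of e' w] by (simp add: S'_def cinner_simps norm_eq_1_iff_cinner)
  have norm_e: "(norm (e + z))\<^sup>2 = 1 + (norm z)\<^sup>2" if "z \<in> S" for z
    using cinner_e[OF that that] by (simp add: norm_sq_eq_Re_cinner)
  have norm_e': "(norm (e' + z))\<^sup>2 = 1 + (norm z)\<^sup>2" if "z \<in> S'" for z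
    using cinner_e'[OF that that] by (simp add: norm_sq_eq_Re_cinner)
  have "\<exists>z'. z' \<in> S' \<and> \<phi> (line_through (e + z)) = line_through (e' + z')" if z: "z \<in> S" for z
  proof -
    obtain y where y: "norm y = 1" "\<phi> (line_through (e + z)) = line_through y"
      using \<phi>_lines[of "line_through (e + z)"] nz[OF z] by (metis lines_unitE line_through_in_lines)
    have "cinner (e + z) e = 1"
      using z e by (simp add: S_def cinner_simps norm_eq_1_iff_cinner)
    then have "cinner y e' \<noteq> 0"
      using overlap[of "e + z" e y e'] nz[OF z] e0 y e' norm_zero by fastforce
    moreover define z' where "z' = (1 / cinner y e') *\<^sub>C y - e'"
    ultimately have "z' \<in> S'" "line_through (e' + z') = line_through y"
      using e' by (simp_all add: S'_def cinner_simps line_through_scaleC norm_eq_1_iff_cinner)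
    then show ?thesis
      using y by metis
  qed
  then obtain T where T: "\<And>z. z \<in> S \<Longrightarrow> T z \<in> S'"
    "\<And>z. z \<in> S \<Longrightarrow> \<phi> (line_through (e + z)) = line_through (e' + T z)"
    by metis
  \<comment> \<open>The components along \<open>e\<close> and \<open>e'\<close> are normalised to 1,
    so the overlap of \<open>e + z\<close> with \<open>e\<close> determines the norm of
    \<open>z\<close>.\<close>
  have norm_T: "norm (T z) = norm z" if z: "z \<in> S" for z
  proof -
    have "cinner e (e + z) = 1" "cinner e' (e' + T z) = 1"
      using z T(1)[OF z] e e' cinner_eq_zero_commute[of e z] cinner_eq_zero_commute[of e' "T z"]
      by (simp_all add: S_def S'_def cinner_simps norm_eq_1_iff_cinner)
    then have "norm (e' + T z) = norm (e + z)"
      using overlap[of e "e + z" e' "e' + T z"] T[OF z] nz[OF z] nz'[OF T(1)[OF z]] e e' e0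
      by (simp add: divide_simps)
    then have "1 + (norm (T z))\<^sup>2 = 1 + (norm z)\<^sup>2"
      using norm_e[OF z] norm_e'[OF T(1)[OF z]] by simp
    then show ?thesis
      by simp
  qed
  have norm_eT: "norm (e' + T z) = norm (e + z)" if z: "z \<in> S" for z
    by (rule power2_eq_imp_eq) (simp_all add: norm_e norm_e' T norm_T z)
  \<comment> \<open>Comparing \<open>z\<close> with \<open>e + z\<close> gives equality in
    Cauchy-Schwarz for \<open>T z\<close> and a representative \<open>y\<close> of the image of
    \<open>[z]\<close>.\<close>
  have phi_T: "\<phi> (line_through z) = line_through (T z)" if z: "z \<in> S" "z \<noteq> 0" for z
  proof -
    obtain y where y: "norm y = 1" "\<phi> (line_through z) = line_through y"
      using \<phi>_lines[of "line_through z"] z by (metis lines_unitE line_through_in_lines)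
    have y0: "y \<noteq> 0" and T0: "T z \<noteq> 0"
      using y norm_T[OF z(1)] z(2) by auto
    have ye: "cinner y e' = 0"
      using overlap[of z e y e'] z y y0 e' e0 by (simp add: S_def)
    have "cinner z (e + z) = complex_of_real ((norm z)\<^sup>2)" "cinner y (e' + T z) = cinner y (T z)"
      using z ye by (simp_all add: S_def cinner_simps cinner_self)
    then have "cmod (cinner y (T z)) / norm (e' + T z) = norm z / norm (e + z)"
      using overlap[of z "e + z" y "e' + T z"] T[OF z(1)] nz[OF z(1)] nz'[OF T(1)[OF z(1)]] z y y0
      by (simp add: norm_mult power2_eq_square)
    then have "cmod (cinner y (T z)) = norm y * norm (T z)"
      using nz[OF z(1)] norm_T[OF z(1)] norm_eT[OF z(1)] y by simp
    then obtain c where c: "y = c *\<^sub>C T z"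
      using cmod_cinner_eq_norm_multD T0 by metis
    then have "c \<noteq> 0"
      using y0 by auto
    then show ?thesis
      using y c line_through_scaleC by metis
  qed
  \<comment> \<open>The pair \<open>z\<close>, \<open>w\<close> yields the modulus of
    \<open>cinner z w\<close>, and the pair \<open>e + z\<close>, \<open>e + w\<close> the modulus
    of \<open>1 + cinner z w\<close>; together they fix its real part.\<close>
  have inner_T: "inner (T z) (T w) = inner z w" if zw: "z \<in> S" "w \<in> S" for z w
  proof (cases "z = 0 \<or> w = 0")
    case True
    moreover have "T 0 = 0"
      using norm_T[of 0] by (simp add: S_def)
    ultimately show ?thesis
      by auto
  next
    case False
    then have T0: "T z \<noteq> 0" "T w \<noteq> 0"
      using norm_T zw by (metis norm_eq_zero)+
    have 1: "cmod (cinner (T z) (T w)) = cmod (cinner z w)"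
      using overlap[of z w "T z" "T w"] phi_T zw False T0 norm_T by simp
    have "cmod (1 + cinner (T z) (T w)) = cmod (1 + cinner z w)"
      using overlap[of "e + z" "e + w" "e' + T z" "e' + T w"] T zw nz nz' cinner_e cinner_e' norm_eT
      by simp
    moreover have "(cmod (1 + c))\<^sup>2 = 1 + 2 * Re c + (cmod c)\<^sup>2" for c
      by (simp add: cmod_power2 power2_sum)
    ultimately have "1 + 2 * Re (cinner (T z) (T w)) + (cmod (cinner (T z) (T w)))\<^sup>2 =
        1 + 2 * Re (cinner z w) + (cmod (cinner z w))\<^sup>2"
      by metis
    then show ?thesis
      using 1 by (simp add: inner_eq_Re_cinner)
  qed
  have T_real: "T (a *\<^sub>R x + b *\<^sub>R y) = a *\<^sub>R T x + b *\<^sub>R T y" if "x \<in> S" "y \<in> S" for a b x y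
    using that by (intro real_inner_preserving_additive[of S] inner_T S_add S_scaleR)
  have T_add: "T (x + y) = T x + T y" if "x \<in> S" "y \<in> S" for x y
    using T_real[OF that, of 1 1] by simp
  have T_i: "T (\<i> *\<^sub>C z) = \<i> *\<^sub>C T z \<or> T (\<i> *\<^sub>C z) = - (\<i> *\<^sub>C T z)" if z: "z \<in> S" for z
  proof (cases "z = 0")
    case True
    then show ?thesis
      using norm_T[OF z] by simp
  next
    case False
    have iz: "\<i> *\<^sub>C z \<in> S" "\<i> *\<^sub>C z \<noteq> 0"
      using S_scale[OF z] False by auto
    have "line_through (T (\<i> *\<^sub>C z)) = line_through (T z)"
      using phi_T[OF iz] phi_T[OF z False] by (simp add: line_through_scaleC)
    moreover have "T (\<i> *\<^sub>C z) \<noteq> 0" and Tz: "T z \<noteq> 0"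
      using norm_T[OF iz(1)] iz(2) norm_T[OF z] False by auto
    ultimately obtain c where c: "T (\<i> *\<^sub>C z) = c *\<^sub>C T z"
      using line_through_eqD by metis
    have "cmod c = 1"
      using norm_T[OF iz(1)] norm_T[OF z] False by (simp add: c norm_scaleC)
    \<comment> \<open>\<open>z\<close> and \<open>\<i> *\<^sub>C z\<close> are orthogonal in the
      real inner product, which \<open>T\<close> preserves; with modulus 1 only
      \<open>c = \<i>\<close> and \<open>c = - \<i>\<close> remain.\<close>
    moreover have "Re c = 0"
      using inner_T[OF z iz(1)] Tz
      by (simp add: c inner_i_scaleC_self) (simp add: inner_eq_Re_cinner cinner_simps cinner_self)
    ultimately have "c = \<i> \<or> c = - \<i>"
      using cmod_power2[of c] by (auto simp: complex_eq_iff power2_eq_1_iff)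
    then show ?thesis
      using c complex_vector.scale_minus_left[of \<i> "T z"] by auto
  qed
  \<comment> \<open>The sign does not depend on the vector: with opposite signs at \<open>z\<close>
    and \<open>w\<close>, either sign at \<open>z + w\<close> contradicts additivity unless
    \<open>T z\<close> or \<open>T w\<close> vanishes.\<close>
  have T_i_consistent: "T (\<i> *\<^sub>C w) = s *\<^sub>R \<i> *\<^sub>C T w"
    if z: "z \<in> S" "z \<noteq> 0" "T (\<i> *\<^sub>C z) = s *\<^sub>R \<i> *\<^sub>C T z" and s: "s = 1 \<or> s = - 1" and w: "w \<in> S" for z w s
  proof (rule ccontr)
    assume neg: "T (\<i> *\<^sub>C w) \<noteq> s *\<^sub>R \<i> *\<^sub>C T w"
    then have w': "T (\<i> *\<^sub>C w) = - s *\<^sub>R \<i> *\<^sub>C T w"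
      using T_i[OF w] s by auto
    obtain r where r: "r = 1 \<or> r = - 1" "T (\<i> *\<^sub>C (z + w)) = r *\<^sub>R \<i> *\<^sub>C T (z + w)"
      using T_i[OF S_add[OF z(1) w]] by (metis scaleR_one scaleR_minus1_left)
    have "T (\<i> *\<^sub>C (z + w)) = s *\<^sub>R \<i> *\<^sub>C T z - s *\<^sub>R \<i> *\<^sub>C T w"
      using T_add[OF S_scale[OF z(1)] S_scale[OF w], of \<i> \<i>] z(3) w' by (simp add: scaleC_add_right)
    then have eq: "s *\<^sub>R \<i> *\<^sub>C T z - s *\<^sub>R \<i> *\<^sub>C T w = r *\<^sub>R \<i> *\<^sub>C T z + r *\<^sub>R \<i> *\<^sub>C T w"
      using r(2) T_add[OF z(1) w] by (simp add: scaleC_add_right scaleR_add_right)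
    have self_neg: "x = 0" if "- x = x" for x :: 'a
      using that scaleR_2[of x] by (metis add.right_inverse scaleR_eq_0_iff zero_neq_numeral)
    have "s *\<^sub>R \<i> *\<^sub>C T w = 0 \<or> s *\<^sub>R \<i> *\<^sub>C T z = 0"
    proof (cases "r = s")
      case True
      then show ?thesis
        using eq self_neg[of "s *\<^sub>R \<i> *\<^sub>C T w"] by simp
    next
      case False
      then have "r = - s"
        using r(1) s by auto
      then show ?thesis
        using eq self_neg[of "s *\<^sub>R \<i> *\<^sub>C T z"] by simp
    qed
    then have "T w = 0 \<or> T z = 0"
      using s by auto
    moreover have "T w = 0 \<Longrightarrow> T (\<i> *\<^sub>C w) = 0"
      using norm_T[OF w] norm_T[OF S_scale[OF w, of \<i>]] by (simp add: norm_scaleC)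
    ultimately show False
      using neg norm_T[OF z(1)] z(2) by auto
  qed
  obtain s where s: "s = 1 \<or> s = (- 1 :: real)" and T_is: "\<And>w. w \<in> S \<Longrightarrow> T (\<i> *\<^sub>C w) = s *\<^sub>R \<i> *\<^sub>C T w"
  proof (cases "\<exists>z\<in>S. z \<noteq> 0")
    case True
    then obtain z where z: "z \<in> S" "z \<noteq> 0"
      by blast
    then obtain s :: real where "s = 1 \<or> s = - 1" "T (\<i> *\<^sub>C z) = s *\<^sub>R \<i> *\<^sub>C T z"
      using T_i[OF z(1)] by (metis scaleR_one scaleR_minus1_left)
    then show thesis
      using that T_i_consistent[OF z] by blast
  next
    \<comment> \<open>Here \<open>S\<close> is \<open>{0}\<close> and both sides vanish, so the
      choice of sign is arbitrary.\<close>
    case False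
    have "T (\<i> *\<^sub>C w) = 1 *\<^sub>R \<i> *\<^sub>C T w" if "w \<in> S" for w
      using False that norm_T[OF that] by auto
    then show thesis
      using that by blast
  qed
  define \<sigma> where "\<sigma> = (if s = 1 then (\<lambda>c. c) else cnj)"
  have \<sigma>: "\<sigma> = (\<lambda>c. c) \<or> \<sigma> = cnj"
    by (simp add: \<sigma>_def)
  have \<sigma>_hom: "\<sigma> (a + b) = \<sigma> a + \<sigma> b" "\<sigma> (a * b) = \<sigma> a * \<sigma> b" "cmod (\<sigma> a) = cmod a"
    "\<sigma> 0 = 0" "\<sigma> 1 = 1" for a b
    by (simp_all add: \<sigma>_def)
  have T_scale: "T (c *\<^sub>C z) = \<sigma> c *\<^sub>C T z" if z: "z \<in> S" for c z
  proof -
    have "T (c *\<^sub>C z) = Re c *\<^sub>R T z + Im c *\<^sub>R s *\<^sub>R \<i> *\<^sub>C T z"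
      using T_real[OF z S_scale[OF z, of \<i>], of "Re c" "Im c"]
      unfolding T_is[OF z] scaleC_Re_Im[of c z, symmetric] .
    also have "\<dots> = \<sigma> c *\<^sub>C T z"
      using s scaleC_Re_Im[of "\<sigma> c" "T z"] by (auto simp: \<sigma>_def)
    finally show ?thesis .
  qed
  define P where "P x = x - cinner x e *\<^sub>C e" for x
  have P_S: "P x \<in> S" for x
    using e by (simp add: P_def S_def cinner_simps norm_eq_1_iff_cinner)
  have x_P: "x = cinner x e *\<^sub>C e + P x" for x
    by (simp add: P_def)
  \<comment> \<open>The \<open>\<sigma>\<close>-semilinear extension of \<open>T\<close> with
    \<open>U e = e'\<close>. For \<open>c = cinner v e\<close> nonzero, \<open>v\<close> is
    \<open>c\<close> times a vector \<open>e + z\<close> with \<open>z\<close> in \<open>S\<close>,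
    whose image line is known; for \<open>c = 0\<close>, \<open>phi_T\<close> applies.\<close>
  define U where "U x = \<sigma> (cinner x e) *\<^sub>C e' + T (P x)" for x
  show ?thesis
  proof (rule Wigner_symmetryI[OF \<sigma>])
    fix x y
    have "P (x + y) = P x + P y"
      by (simp add: P_def cinner_simps scaleC_add_left)
    then show "U (x + y) = U x + U y"
      by (simp add: U_def cinner_simps \<sigma>_hom scaleC_add_left T_add P_S)
  next
    fix c x
    have "P (c *\<^sub>C x) = c *\<^sub>C P x"
      by (simp add: P_def cinner_simps complex_vector.scale_right_diff_distrib scaleC_scaleC)
    then show "U (c *\<^sub>C x) = \<sigma> c *\<^sub>C U x"
      by (simp add: U_def cinner_simps \<sigma>_hom scaleC_add_right scaleC_scaleC T_scale P_S)
  next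
    fix x
    have "cinner e (P x) = 0" "cinner e' (T (P x)) = 0"
      using P_S[of x] T(1)[OF P_S[of x]] cinner_eq_zero_commute by (metis (mono_tags) S_def S'_def mem_Collect_eq)+
    then have "(norm (U x))\<^sup>2 = (norm (cinner x e *\<^sub>C e + P x))\<^sup>2"
      unfolding U_def by (simp add: norm_add_scaleC_sq e e' \<sigma>_hom norm_T P_S)
    then show "norm (U x) = norm x"
      by (simp add: x_P [symmetric])
  next
    fix v :: 'a
    assume v: "v \<noteq> 0"
    define c where "c = cinner v e"
    show "\<phi> (line_through v) = line_through (U v)"
    proof (cases "c = 0")
      case True
      then have "P v = v"
        by (simp add: P_def c_def)
      then show ?thesis
        using phi_T[of v] P_S[of v] v True by (simp add: U_def c_def \<sigma>_hom)
    next
      case False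
      have S: "(1 / c) *\<^sub>C P v \<in> S"
        by (intro S_scale P_S)
      have "v = c *\<^sub>C (e + (1 / c) *\<^sub>C P v)"
        using x_P[of v] False by (simp add: scaleC_add_right scaleC_scaleC scaleC_one c_def)
      then have "line_through v = line_through (e + (1 / c) *\<^sub>C P v)"
        using line_through_scaleC[OF False] by metis
      then have 1: "\<phi> (line_through v) = line_through (e' + \<sigma> (1 / c) *\<^sub>C T (P v))"
        using T(2)[OF S] by (simp add: T_scale P_S)
      have "\<sigma> c * \<sigma> (1 / c) = 1"
        using False \<sigma>_hom(2)[of c "1 / c"] \<sigma>_hom(5) by simp
      then have "U v = \<sigma> c *\<^sub>C (e' + \<sigma> (1 / c) *\<^sub>C T (P v))"
        by (simp add: U_def c_def scaleC_add_right scaleC_scaleC scaleC_one)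
      moreover have "\<sigma> c \<noteq> 0"
        using \<open>\<sigma> c * \<sigma> (1 / c) = 1\<close> by auto
      ultimately show ?thesis
        using 1 line_through_scaleC by metis
    qed
  next
    show "lines \<subseteq> \<phi> ` lines"
      using bij by (simp add: bij_betw_def)
  qed
qed

subsection \<open>The angle \<open>\<pi>/4\<close>\<close>

text \<open>This simp rule would turn \<open>\<theta> = \<pi>/4\<close> into \<open>\<theta> * 4 = \<pi>\<close>.\<close>

declare eq_divide_eq_numeral1 [simp del]

section \<open>Lines at angle \<pi>/4 in terms of overlaps\<close>

lemma line_angle_eq_quarter_iff:
  fixes x y :: "'a::complex_inner"
  assumes "x \<noteq> 0" "y \<noteq> 0"
  shows "line_angle (line_through x) (line_through y) = pi / 4 \<longleftrightarrow>
    2 * (cmod (cinner x y))\<^sup>2 = (norm x)\<^sup>2 * (norm y)\<^sup>2"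
proof -
  define q where "q = cmod (cinner x y) / (norm x * norm y)"
  have "0 \<le> q" "q \<le> 1"
    using assms cmod_cinner_le[of x y] by (auto simp: q_def divide_le_eq_1)
  then have q: "0 \<le> q" "cos (arccos q) = q"
    by simp_all
  have "arccos q = pi / 4 \<longleftrightarrow> q = cos (pi / 4)"
    using q(2) arccos_cos[of "pi / 4"] by auto
  also have "\<dots> \<longleftrightarrow> q\<^sup>2 = (cos (pi / 4))\<^sup>2"
    using q by (subst power2_eq_iff_nonneg) (auto simp: cos_45)
  also have "\<dots> \<longleftrightarrow> 2 * q\<^sup>2 = 1"
    by (auto simp: cos_45 power_divide)
  also have "\<dots> \<longleftrightarrow> 2 * (cmod (cinner x y))\<^sup>2 = (norm x)\<^sup>2 * (norm y)\<^sup>2"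
    using assms by (simp add: q_def power_divide power_mult_distrib divide_simps)
  finally show ?thesis
    using assms by (simp add: line_angle_line_through q_def)
qed

lemma line_angle_eq_right_iff:
  fixes x y :: "'a::complex_inner"
  assumes "x \<noteq> 0" "y \<noteq> 0"
  shows "line_angle (line_through x) (line_through y) = pi / 2 \<longleftrightarrow> cinner x y = 0"
proof -
  define q where "q = cmod (cinner x y) / (norm x * norm y)"
  have "0 \<le> q" "q \<le> 1"
    using assms cmod_cinner_le[of x y] by (auto simp: q_def divide_le_eq_1)
  then have q: "0 \<le> q" "cos (arccos q) = q"
    by simp_all
  have "arccos q = pi / 2 \<longleftrightarrow> q = 0"
    using q(2) by auto
  then show ?thesis
    using assms by (simp add: line_angle_line_through q_def)
qed

text \<open>The squared overlaps 1/2 and 1/2 exhaust the squared norm of \<open>w\<close>, leaving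
  no component outside the span of \<open>u\<close> and \<open>v\<close>.\<close>

lemma equidistant_from_orthogonal:
  fixes u v w :: "'a::complex_inner"
  assumes "norm u = 1" "norm v = 1" "norm w = 1" "cinner u v = 0"
    and "2 * (cmod (cinner w u))\<^sup>2 = 1" "2 * (cmod (cinner w v))\<^sup>2 = 1"
  shows "w = cinner w u *\<^sub>C u + cinner w v *\<^sub>C v"
proof -
  define x where "x = w - cinner w u *\<^sub>C u"
  have x2: "2 * (norm x)\<^sup>2 = 1"
    using norm_residual[OF assms(1), of w] assms by (simp add: x_def)
  have xv: "cinner x v = cinner w v"
    using assms(4) by (simp add: x_def cinner_simps)
  have "(norm (x - cinner w v *\<^sub>C v))\<^sup>2 = 0"
    using norm_residual[OF assms(2), of x] assms(6) x2 unfolding xv by linarith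
  then show ?thesis
    by (simp add: x_def algebra_simps)
qed

lemma line_equidistant_from_orthogonal:
  fixes u v :: "'a::complex_inner"
  assumes uv: "norm u = 1" "norm v = 1" "cinner u v = 0" and W: "W \<in> lines"
    and "line_angle (line_through u) W = pi / 4" "line_angle (line_through v) W = pi / 4"
  obtains l where "cmod l = 1" "W = line_through (u + l *\<^sub>C v)"
proof -
  obtain w where w: "norm w = 1" "W = line_through w"
    using W by (rule lines_unitE)
  have nz: "u \<noteq> 0" "v \<noteq> 0" "w \<noteq> 0"
    using uv w by auto
  define a where "a = cinner w u"
  define b where "b = cinner w v"
  have ab: "2 * (cmod a)\<^sup>2 = 1" "2 * (cmod b)\<^sup>2 = 1"
    using assms(5,6) nz uv w
    by (simp_all add: a_def b_def line_angle_eq_quarter_iff cmod_cinner_commute[of w])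
  then have wab: "w = a *\<^sub>C u + b *\<^sub>C v"
    unfolding a_def b_def using equidistant_from_orthogonal uv w by blast
  have "(cmod a)\<^sup>2 = (cmod b)\<^sup>2"
    using ab by linarith
  then have eq: "cmod a = cmod b"
    by (rule power2_eq_imp_eq) auto
  have a0: "a \<noteq> 0" "b \<noteq> 0"
    using ab by auto
  have "w = a *\<^sub>C (u + (b / a) *\<^sub>C v)"
    using a0 by (simp add: wab scaleC_add_right scaleC_scaleC)
  then have "W = line_through (u + (b / a) *\<^sub>C v)"
    using w(2) line_through_scaleC[OF a0(1)] by metis
  moreover have "cmod (b / a) = 1"
    using eq a0 by (simp add: norm_divide)
  ultimately show thesis
    using that by blast
qed

text \<open>For \<open>p = l * cnj m\<close> of modulus 1, the angle \<pi>/4 means that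
  \<open>1 + p\<close> has squared modulus 2. So \<open>p\<close> is purely imaginary, hence
  \<open>\<i>\<close> or \<open>- \<i>\<close>.\<close>

lemma circle_adjacent:
  fixes u v :: "'a::complex_inner"
  assumes uv: "norm u = 1" "norm v = 1" "cinner u v = 0" and l: "cmod l = 1" "cmod m = 1"
    and "line_angle (line_through (u + l *\<^sub>C v)) (line_through (u + m *\<^sub>C v)) = pi / 4"
  shows "m = \<i> * l \<or> m = - \<i> * l"
proof -
  have vu: "cinner v u = 0"
    using uv by (simp add: cinner_eq_zero_commute)
  have ip: "cinner (u + k *\<^sub>C v) (u + k' *\<^sub>C v) = 1 + k * cnj k'" for k k'
    using uv vu by (simp add: cinner_simps norm_eq_1_iff_cinner)
  have n: "(norm (u + k *\<^sub>C v))\<^sup>2 = 2" if "cmod k = 1" for k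
    using that by (simp add: norm_sq_eq_Re_cinner ip complex_mult_cnj cmod_power2 [symmetric])
  then have nz: "u + k *\<^sub>C v \<noteq> 0" if "cmod k = 1" for k
    using that by fastforce
  define p where "p = l * cnj m"
  have "(cmod (1 + p))\<^sup>2 = 2"
    using assms(6) line_angle_eq_quarter_iff[OF nz[OF l(1)] nz[OF l(2)]] n l by (simp add: ip p_def)
  moreover have "cmod p = 1"
    using l by (simp add: p_def norm_mult)
  moreover have "(cmod (1 + p))\<^sup>2 = 1 + 2 * Re p + (cmod p)\<^sup>2"
    by (simp add: cmod_power2 power2_sum)
  ultimately have "Re p = 0" "(Im p)\<^sup>2 = 1"
    using cmod_power2[of p] by simp_all
  then have p: "p = \<i> \<or> p = - \<i>"
    by (auto simp: complex_eq_iff power2_eq_1_iff)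
  have "cnj p * l = m * (l * cnj l)"
    by (simp add: p_def)
  also have "\<dots> = m"
    using l by (simp add: complex_norm_square [symmetric])
  finally show ?thesis
    using p by auto
qed

context
  assumes dim3: "cdim_at_least 3 TYPE('a::complex_inner)"
begin

text \<open>
  The common neighbours of orthogonal lines at angle \<open>\<pi>/4\<close> are the lines
  \<open>[u + l v]\<close> with \<open>\<bar>l\<bar> = 1\<close>, and each has only two neighbours among them. For lines that are not
  orthogonal, one of the common neighbours lies in their span and has a whole circle of neighbours
  outside the span.
\<close>

lemma orthogonal_lines_iff:
  fixes L M :: "'a set"
  assumes LM: "L \<in> lines" "M \<in> lines"
  shows "line_angle L M = pi / 2 \<longleftrightarrow> L \<noteq> M \<and>
    \<not> (\<exists>W\<in>lines. \<exists>W1\<in>lines. \<exists>W2\<in>lines. \<exists>W3\<in>lines. distinct [W1, W2, W3] \<and>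
      (\<forall>X\<in>{W, W1, W2, W3}. line_angle L X = pi / 4 \<and> line_angle M X = pi / 4) \<and>
      (\<forall>X\<in>{W1, W2, W3}. line_angle W X = pi / 4))"
    (is "_ \<longleftrightarrow> _ \<and> \<not> ?E")
proof (intro iffI conjI)
  assume orth: "line_angle L M = pi / 2"
  show "L \<noteq> M"
    using orth line_angle_eq_0_iff[OF LM] by auto
  obtain u v where u: "norm u = 1" "L = line_through u" and v: "norm v = 1" "M = line_through v"
    using LM by (metis lines_unitE)
  have "u \<noteq> 0" "v \<noteq> 0"
    using u v by auto
  then have uv: "cinner u v = 0"
    using orth u v by (simp add: line_angle_eq_right_iff)
  show "\<not> ?E"
  proof
    assume ?E
    then obtain W W1 W2 W3 where
      W: "W \<in> lines" "W1 \<in> lines" "W2 \<in> lines" "W3 \<in> lines" "distinct [W1, W2, W3]"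
      and LMW: "\<And>X. X \<in> {W, W1, W2, W3} \<Longrightarrow> line_angle L X = pi / 4 \<and> line_angle M X = pi / 4"
      and WW: "\<And>X. X \<in> {W1, W2, W3} \<Longrightarrow> line_angle W X = pi / 4"
      by auto
    have rep: "\<exists>l. cmod l = 1 \<and> X = line_through (u + l *\<^sub>C v)" if "X \<in> {W, W1, W2, W3}" for X
    proof -
      have "X \<in> lines"
        using that W by auto
      then show ?thesis
        using line_equidistant_from_orthogonal[OF u(1) v(1) uv, of X] LMW[OF that] u v by metis
    qed
    obtain l where l: "cmod l = 1" "W = line_through (u + l *\<^sub>C v)"
      using rep[of W] by auto
    have "X \<in> {line_through (u + (\<i> * l) *\<^sub>C v), line_through (u + (- \<i> * l) *\<^sub>C v)}"
      if X: "X \<in> {W1, W2, W3}" for X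
    proof -
      obtain m where m: "cmod m = 1" "X = line_through (u + m *\<^sub>C v)"
        using rep[of X] X by auto
      then have "m = \<i> * l \<or> m = - \<i> * l"
        using circle_adjacent[OF u(1) v(1) uv l(1) m(1)] WW[OF X] l by simp
      then show ?thesis
        using m by auto
    qed
    from this[of W1] this[of W2] this[of W3] show False
      using W(5) by auto
  qed
next
  assume H: "L \<noteq> M \<and> \<not> ?E"
  obtain u f g t where on:
    "norm u = 1" "norm f = 1" "norm g = 1" "cinner u f = 0" "cinner u g = 0" "cinner f g = 0"
    and t: "t = line_angle L M" "0 \<le> t" "t \<le> pi / 2"
    and L: "L = line_through u"
    and M: "M = line_through (complex_of_real (cos t) *\<^sub>C u + complex_of_real (sin t) *\<^sub>C f + 0 *\<^sub>C g)"
    using lines_orthonormalE[OF dim3 LM] by metis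
  show "line_angle L M = pi / 2"
  proof (rule ccontr)
    assume "line_angle L M \<noteq> pi / 2"
    then have t2: "t < pi / 2"
      using t by simp
    define c where "c = cos t"
    define s where "s = sin t"
    have "t \<noteq> 0"
      using H line_angle_eq_0_iff[OF LM] t by simp
    have cs: "0 < c" "c\<^sup>2 + s\<^sup>2 = 1"
      using t t2 by (auto simp: c_def s_def intro!: cos_gt_zero_pi)
    define vec :: "complex \<Rightarrow> complex \<Rightarrow> complex \<Rightarrow> 'a"
      where "vec a b d = a *\<^sub>C u + b *\<^sub>C f + d *\<^sub>C g" for a b d
    have ip: "cinner (vec a b d) (vec a' b' d') = a * cnj a' + b * cnj b' + d * cnj d'" for a b d a' b' d'
      unfolding vec_def by (rule cinner_orthonormal[OF on])
    have n: "(norm (vec a b d))\<^sup>2 = (cmod a)\<^sup>2 + (cmod b)\<^sup>2 + (cmod d)\<^sup>2" for a b d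
      by (simp add: norm_sq_eq_Re_cinner ip complex_mult_cnj cmod_power2)
    have nz: "vec 1 b d \<noteq> 0" for b d
      using n[of 1 b d] by (auto simp: add_nonneg_eq_0_iff)
    have u: "u = vec 1 0 0"
      by (simp add: vec_def scaleC_one)
    define v where "v = vec (complex_of_real c) (complex_of_real s) 0"
    have Mv: "M = line_through v"
      by (simp add: M v_def vec_def c_def s_def)
    have v1: "(norm v)\<^sup>2 = 1"
      using cs by (simp add: v_def n)
    then have v0: "v \<noteq> 0"
      by auto
    \<comment> \<open>The positive root of \<open>\<rho>\<^sup>2 + 2 * c * \<rho> = 1\<close>. With
      \<open>p\<close> below, both the overlap of \<open>y \<omega>\<close> with \<open>v\<close>
      and that with \<open>x\<close> reduce to this equation. As \<open>c > 0\<close>, the root is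
      below 1, so \<open>q > 0\<close> and the lines through \<open>y \<omega>\<close> form a
      genuine circle.\<close>
    define \<rho> where "\<rho> = sqrt (1 + c\<^sup>2) - c"
    have \<rho>2: "\<rho>\<^sup>2 + 2 * c * \<rho> = 1"
    proof -
      have "(\<rho> + c)\<^sup>2 = 1 + c\<^sup>2"
        by (simp add: \<rho>_def)
      then show ?thesis
        by (simp add: power2_sum algebra_simps)
    qed
    have "sqrt (c\<^sup>2) < sqrt (1 + c\<^sup>2)"
      by (rule real_sqrt_less_mono) simp
    then have \<rho>0: "0 < \<rho>"
      using cs by (simp add: \<rho>_def)
    then have \<rho>1: "\<rho>\<^sup>2 < 1"
      using \<rho>2 cs mult_pos_pos[of c \<rho>] by linarith
    define p where "p = complex_of_real \<rho> * (complex_of_real s + \<i> * complex_of_real c)"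
    define q where "q = sqrt (1 - \<rho>\<^sup>2)"
    have q: "0 < q" "q\<^sup>2 = 1 - \<rho>\<^sup>2"
      using \<rho>1 by (auto simp: q_def)
    have p: "(cmod p)\<^sup>2 = \<rho>\<^sup>2"
      using cs by (simp add: p_def norm_mult power_mult_distrib cmod_power2)
    define x where "x = vec 1 \<i> 0"
    define y where "y \<omega> = vec 1 p (complex_of_real q * \<omega>)" for \<omega> :: complex
    have x2: "(norm x)\<^sup>2 = 2"
      by (simp add: x_def n)
    have y2: "(norm (y \<omega>))\<^sup>2 = 2" if "cmod \<omega> = 1" for \<omega>
      using that p q by (simp add: y_def n norm_mult)
    have xy0: "x \<noteq> 0" "y \<omega> \<noteq> 0" for \<omega>
      by (simp_all add: x_def y_def nz)
    have u0: "u \<noteq> 0"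
      using on by auto
    have Lx: "line_angle L (line_through x) = pi / 4"
      unfolding L using u0 xy0 on by (simp add: line_angle_eq_quarter_iff x2) (simp add: x_def u ip)
    have Ly: "line_angle L (line_through (y \<omega>)) = pi / 4" if "cmod \<omega> = 1" for \<omega>
      unfolding L using u0 xy0 on that by (simp add: line_angle_eq_quarter_iff y2) (simp add: y_def u ip)
    have Mx: "line_angle M (line_through x) = pi / 4"
    proof -
      have "(cmod (cinner v x))\<^sup>2 = 1"
        using cs by (simp add: v_def x_def ip cmod_power2)
      then show ?thesis
        unfolding Mv using v0 xy0 v1 x2 by (simp add: line_angle_eq_quarter_iff)
    qed
    have My: "line_angle M (line_through (y \<omega>)) = pi / 4" if "cmod \<omega> = 1" for \<omega>
    proof -
      have "(cmod (cinner v (y \<omega>)))\<^sup>2 = (c + s * (\<rho> * s))\<^sup>2 + (s * (\<rho> * c))\<^sup>2"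
        by (simp add: v_def y_def ip cmod_power2 p_def)
      also have "\<dots> = c\<^sup>2 + s\<^sup>2 * (2 * c * \<rho> + \<rho>\<^sup>2 * (c\<^sup>2 + s\<^sup>2))"
        by (simp add: power2_eq_square algebra_simps)
      also have "\<dots> = c\<^sup>2 + s\<^sup>2 * (\<rho>\<^sup>2 + 2 * c * \<rho>)"
        using cs by (simp add: algebra_simps)
      also have "\<dots> = 1"
        using \<rho>2 cs by simp
      finally show ?thesis
        unfolding Mv using v0 xy0 v1 y2[OF that] by (simp add: line_angle_eq_quarter_iff)
    qed
    have xy: "line_angle (line_through x) (line_through (y \<omega>)) = pi / 4" if "cmod \<omega> = 1" for \<omega>
    proof -
      have "(cmod (cinner x (y \<omega>)))\<^sup>2 = (1 + \<rho> * c)\<^sup>2 + (\<rho> * s)\<^sup>2"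
        by (simp add: x_def y_def ip cmod_power2 p_def)
      also have "\<dots> = 1 + 2 * c * \<rho> + \<rho>\<^sup>2 * (c\<^sup>2 + s\<^sup>2)"
        by (simp add: power2_eq_square algebra_simps)
      also have "\<dots> = 2"
        using \<rho>2 cs by simp
      finally show ?thesis
        using xy0 x2 y2[OF that] by (simp add: line_angle_eq_quarter_iff)
    qed
    have inj: "\<omega> = \<omega>'" if eq: "line_through (y \<omega>) = line_through (y \<omega>')" for \<omega> \<omega>'
    proof -
      obtain k where k: "y \<omega> = k *\<^sub>C y \<omega>'"
        using line_through_eqD[OF eq xy0(2)] by metis
      have "cinner (y \<omega>) (vec 1 0 0) = k * cinner (y \<omega>') (vec 1 0 0)"
        "cinner (y \<omega>) (vec 0 0 1) = k * cinner (y \<omega>') (vec 0 0 1)"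
        by (simp_all add: k cinner_scaleC_left)
      then show ?thesis
        using q by (simp add: y_def ip)
    qed
    \<comment> \<open>\<open>W\<close> is the line through \<open>x\<close>, and three points of its
      circle of neighbours serve as \<open>W1\<close>, \<open>W2\<close>, \<open>W3\<close>.\<close>
    have "?E"
    proof (intro bexI conjI)
      show "distinct [line_through (y 1), line_through (y (- 1)), line_through (y \<i>)]"
        using inj[of 1 "- 1"] inj[of 1 \<i>] inj[of "- 1" \<i>] by (auto simp: complex_eq_iff)
    qed (use xy0 Lx Ly Mx My xy in auto)
    then show False
      using H by blast
  qed
qed

text \<open>\<open>L\<close> lies in the span of \<open>Y\<close> and \<open>Y'\<close>, and
  \<open>X\<close> is orthogonal to \<open>Y'\<close>. So \<open>X\<close> meets \<open>L\<close>
  only through the component along \<open>Y\<close>, and the overlap is the square of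
  \<open>cos (pi / 4)\<close>, namely 1/2.\<close>

lemma line_angle_eq_third_iff:
  fixes L X :: "'a set"
  assumes "L \<in> lines" "X \<in> lines"
  shows "line_angle L X = pi / 3 \<longleftrightarrow> (\<exists>Y\<in>lines. \<exists>Y'\<in>lines. line_angle Y Y' = pi / 2 \<and>
    line_angle L Y = pi / 4 \<and> line_angle L Y' = pi / 4 \<and> line_angle X Y = pi / 4 \<and> line_angle X Y' = pi / 2)"
proof
  assume third: "line_angle L X = pi / 3"
  obtain u f g t where on:
    "norm u = 1" "norm f = 1" "norm g = 1" "cinner u f = 0" "cinner u g = 0" "cinner f g = 0"
    and t: "t = line_angle L X"
    and L: "L = line_through u"
    and X: "X = line_through (complex_of_real (cos t) *\<^sub>C u + complex_of_real (sin t) *\<^sub>C f + 0 *\<^sub>C g)"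
    using lines_orthonormalE[OF dim3 assms] by metis
  have cs: "cos t = 1 / 2" "sin t = sqrt 3 / 2"
    by (simp_all add: t third cos_60 sin_60)
  define vec :: "complex \<Rightarrow> complex \<Rightarrow> complex \<Rightarrow> 'a"
    where "vec a b d = a *\<^sub>C u + b *\<^sub>C f + d *\<^sub>C g" for a b d
  have ip: "cinner (vec a b d) (vec a' b' d') = a * cnj a' + b * cnj b' + d * cnj d'" for a b d a' b' d'
    unfolding vec_def by (rule cinner_orthonormal[OF on])
  have n: "(norm (vec a b d))\<^sup>2 = (cmod a)\<^sup>2 + (cmod b)\<^sup>2 + (cmod d)\<^sup>2" for a b d
    by (simp add: norm_sq_eq_Re_cinner ip complex_mult_cnj cmod_power2)
  have u: "u = vec 1 0 0"
    by (simp add: vec_def scaleC_one)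
  \<comment> \<open>Orthogonality of \<open>y\<close> and \<open>y'\<close> requires the squares of
    \<open>b\<close> and \<open>d\<close> to sum to 1, and orthogonality of \<open>x\<close> and
    \<open>y'\<close> requires \<open>b\<close> to be \<open>1 / sqrt 3\<close>.\<close>
  define b d where "b = complex_of_real (1 / sqrt 3)" and "d = complex_of_real (sqrt (2 / 3))"
  define x y y' where "x = vec (1 / 2) (complex_of_real (sqrt 3 / 2)) 0"
    and "y = vec 1 b d" and "y' = vec 1 (- b) (- d)"
  have Xx: "X = line_through x"
    by (simp add: X x_def vec_def cs)
  have bd: "(cmod b)\<^sup>2 = 1 / 3" "(cmod d)\<^sup>2 = 2 / 3"
    by (simp_all add: b_def d_def norm_divide power_divide)
  have bb: "b * cnj b = 1 / 3" "d * cnj d = 2 / 3"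
    by (simp_all only: complex_norm_square [symmetric] bd) simp_all
  have sb: "complex_of_real (sqrt 3) * cnj b = 1"
    by (simp add: b_def)
  have norms: "(norm u)\<^sup>2 = 1" "(norm x)\<^sup>2 = 1" "(norm y)\<^sup>2 = 2" "(norm y')\<^sup>2 = 2"
    using on by (simp_all add: x_def y_def y'_def n bd norm_divide power_divide)
  then have nz: "u \<noteq> 0" "x \<noteq> 0" "y \<noteq> 0" "y' \<noteq> 0"
    by auto
  have ips: "cinner y y' = 0" "cinner u y = 1" "cinner u y' = 1" "cinner x y = 1" "cinner x y' = 0"
    by (simp_all add: u x_def y_def y'_def ip bb sb)
  show "\<exists>Y\<in>lines. \<exists>Y'\<in>lines. line_angle Y Y' = pi / 2 \<and>
    line_angle L Y = pi / 4 \<and> line_angle L Y' = pi / 4 \<and> line_angle X Y = pi / 4 \<and> line_angle X Y' = pi / 2"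
    by (rule bexI[of _ "line_through y"], rule bexI[of _ "line_through y'"])
      (simp_all add: L Xx nz ips norms line_angle_eq_quarter_iff line_angle_eq_right_iff)
next
  assume "\<exists>Y\<in>lines. \<exists>Y'\<in>lines. line_angle Y Y' = pi / 2 \<and>
    line_angle L Y = pi / 4 \<and> line_angle L Y' = pi / 4 \<and> line_angle X Y = pi / 4 \<and> line_angle X Y' = pi / 2"
  then obtain Y Y' where Y: "Y \<in> lines" "Y' \<in> lines" "line_angle Y Y' = pi / 2"
    "line_angle L Y = pi / 4" "line_angle L Y' = pi / 4" "line_angle X Y = pi / 4" "line_angle X Y' = pi / 2"
    by blast
  obtain y y' l x where v: "norm y = 1" "Y = line_through y" "norm y' = 1" "Y' = line_through y'"
    "norm l = 1" "L = line_through l" "norm x = 1" "X = line_through x"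
    using Y(1,2) assms by (metis lines_unitE)
  have nz: "y \<noteq> 0" "y' \<noteq> 0" "l \<noteq> 0" "x \<noteq> 0"
    using v by auto
  have ips: "cinner y y' = 0" "2 * (cmod (cinner l y))\<^sup>2 = 1" "2 * (cmod (cinner l y'))\<^sup>2 = 1"
    "2 * (cmod (cinner x y))\<^sup>2 = 1" "cinner x y' = 0"
    using Y v nz by (simp_all add: line_angle_eq_quarter_iff line_angle_eq_right_iff)
  have "l = cinner l y *\<^sub>C y + cinner l y' *\<^sub>C y'"
    using equidistant_from_orthogonal[OF v(1,3,5) ips(1-3)] .
  then have "cinner x l = cnj (cinner l y) * cinner x y"
    using ips(5) by (metis add.right_neutral cinner_add_right cinner_scaleC_right mult_zero_right)
  then have "(cmod (cinner x l))\<^sup>2 = (cmod (cinner l y))\<^sup>2 * (cmod (cinner x y))\<^sup>2"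
    by (simp add: norm_mult power_mult_distrib)
  also have "\<dots> = 1 / 2 * (1 / 2)"
    using ips(2,4) by (intro arg_cong2[where f = "(*)"]) simp_all
  also have "\<dots> = (1 / 2)\<^sup>2"
    by (simp add: power2_eq_square)
  finally have "cmod (cinner x l) = 1 / 2"
    by (rule power2_eq_imp_eq) auto
  then show "line_angle L X = pi / 3"
    using v by (simp add: line_angle_unit_eq_iff cos_60 cmod_cinner_commute[of l])
qed

end

section \<open>A preserved radius below \<pi>/4 in both cases, and the conclusion\<close>

lemma preserves_angle_le_sixth:
  fixes \<phi> :: "'a::complex_inner set \<Rightarrow> 'a set"
  assumes dim3: "cdim_at_least 3 TYPE('a)" and bij: "bij_betw \<phi> lines lines"
    and quarter: "\<And>L M. L \<in> lines \<Longrightarrow> M \<in> lines \<Longrightarrow>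
      line_angle (\<phi> L) (\<phi> M) = pi / 4 \<longleftrightarrow> line_angle L M = pi / 4"
  shows "preserves_angle_le \<phi> (pi / 6)"
proof -
  note [simp] = phi_lines[OF dim3 bij] phi_eq_iff[OF dim3 bij]
  note bex_cong = bex_lines_cong[OF dim3 bij] and ball_cong = ball_lines_cong[OF dim3 bij]
  have right: "line_angle (\<phi> L) (\<phi> M) = pi / 2 \<longleftrightarrow> line_angle L M = pi / 2"
    if LM: "L \<in> lines" "M \<in> lines" for L M
    unfolding orthogonal_lines_iff[OF dim3 LM] orthogonal_lines_iff[OF dim3 LM [THEN phi_lines[OF dim3 bij]]]
    by (intro arg_cong2[where f = "(\<and>)"] arg_cong[where f = Not] bex_cong)
      (use LM quarter in simp_all)
  have third: "line_angle (\<phi> L) (\<phi> M) = pi / 3 \<longleftrightarrow> line_angle L M = pi / 3"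
    if LM: "L \<in> lines" "M \<in> lines" for L M
    unfolding line_angle_eq_third_iff[OF dim3 LM] line_angle_eq_third_iff[OF dim3 LM [THEN phi_lines[OF dim3 bij]]]
    by (intro bex_cong) (use LM quarter right in simp)
  \<comment> \<open>A common neighbour at angles \<pi>/3 and \<pi>/2 exists exactly from the
    difference \<pi>/6 up to the sum 5\<pi>/6, and no angle exceeds \<pi>/2.\<close>
  have sixth_iff: "line_angle L M < pi / 6 \<longleftrightarrow> \<not> (\<exists>Z\<in>lines. line_angle L Z = pi / 3 \<and> line_angle Z M = pi / 2)"
    if LM: "L \<in> lines" "M \<in> lines" for L M :: "'a set"
    using line_angle_bounds[OF LM] by (subst line_triangle_iff[OF dim3 LM]) auto
  have sixth: "line_angle (\<phi> L) (\<phi> M) < pi / 6 \<longleftrightarrow> line_angle L M < pi / 6"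
    if LM: "L \<in> lines" "M \<in> lines" for L M
    unfolding sixth_iff[OF LM] sixth_iff[OF LM [THEN phi_lines[OF dim3 bij]]]
    by (intro arg_cong[where f = Not] bex_cong) (use LM right third in simp)
  have le_iff: "line_angle L M \<le> pi / 6 \<longleftrightarrow> (\<forall>Z\<in>lines. line_angle L Z < pi / 6 \<longrightarrow>
      (\<exists>Y\<in>lines. line_angle Z Y < pi / 6 \<and> line_angle Y M < pi / 6))"
    if "L \<in> lines" "M \<in> lines" for L M :: "'a set"
    by (rule line_angle_le_iff_strict[OF dim3 that]) auto
  have "line_angle (\<phi> L) (\<phi> M) \<le> pi / 6 \<longleftrightarrow> line_angle L M \<le> pi / 6"
    if LM: "L \<in> lines" "M \<in> lines" for L M
    unfolding le_iff[OF LM] le_iff[OF LM [THEN phi_lines[OF dim3 bij]]]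
    by (intro ball_cong arg_cong2[where f = "(\<longrightarrow>)"] bex_cong) (use LM sixth in simp_all)
  then show ?thesis
    unfolding preserves_angle_le_def[OF dim3 bij] by blast
qed

theorem theorem4:
  fixes \<phi> :: "'a::complex_inner set \<Rightarrow> 'a set"
    and \<alpha> :: real
  assumes "cdim_at_least 3 TYPE('a)"
    and "0 < \<alpha>" and "\<alpha> \<le> pi / 4"
    and "bij_betw \<phi> lines lines"
    and "\<And>L M. L \<in> lines \<Longrightarrow> M \<in> lines \<Longrightarrow>
           line_angle L M = \<alpha> \<longleftrightarrow> line_angle (\<phi> L) (\<phi> M) = \<alpha>"
  shows "Wigner_symmetry \<phi>"
proof -
  \<comment> \<open>One preserved radius below \<pi>/4 starts the halving: \<open>pi / 6\<close> if
    \<open>\<alpha> = pi / 4\<close>, and \<open>\<alpha>\<close> itself otherwise.\<close>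
  have "\<exists>\<delta>. preserves_angle_le \<phi> \<delta> \<and> 0 < \<delta> \<and> \<delta> < pi / 4"
  proof (cases "\<alpha> = pi / 4")
    case True
    then have "preserves_angle_le \<phi> (pi / 6)"
      using assms(5) by (intro preserves_angle_le_sixth assms(1,4)) auto
    then show ?thesis
      by (intro exI[of _ "pi / 6"]) auto
  next
    case False
    then have less: "\<alpha> < pi / 4"
      using assms(3) by simp
    have "preserves_angle_le \<phi> \<alpha>"
      by (rule preserves_angle_le_of_eq[OF assms(1,4,2) less]) (rule assms(5) [symmetric])
    then show ?thesis
      using assms(2) less by blast
  qed
  then obtain \<delta> where "preserves_angle_le \<phi> \<delta>" "0 < \<delta>" "\<delta> < pi / 4"
    by blast
  then have angle: "line_angle (\<phi> L) (\<phi> M) = line_angle L M" if "L \<in> lines" "M \<in> lines" for L M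
    using preserves_line_angle[OF assms(1,4)] that by blast
  obtain k :: 'a where "norm k = 1"
    using orthogonal_unit_vector[OF assms(1)] by metis
  then have "\<exists>x::'a. x \<noteq> 0"
    by (metis norm_zero zero_neq_one)
  then show ?thesis
    using Wigner[OF assms(4) angle] by blast
qed

end
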